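(* Let $K$ be a proper cone of $\mathbb{R}^n$, let $A\in\pi(K)$, and let $\lambda$ be a distinguished eigenvalue of $A$ for $K$. Consider the following conditions: (a) $\dim\mathcal{N}(\lambda I-A)=1$. (b) Any $A$-invariant face which contains in its relative interior a generalized eigenvector of $A$ corresponding to $\lambda$ is semi-distinguished $A$-invariant. (c) Any two $A$-invariant faces of $K$ each containing in its relative interior a generalized eigenvector of $A$ corresponding to $\lambda$ are comparable. (d) Any two semi-distinguished $A$-invariant faces of $K$ associated with $\lambda$ are comparable. (e) $\dim\operatorname{span}[\mathcal{N}(\lambda I-A)\cap K]=1$. Then: (i) We always have the implications (a)$\Rightarrow$(b)$\Rightarrow$(c)$\Rightarrow$(d)$\Rightarrow$(e). (ii) Suppose that any $A$-invariant face of $K$ which contains in its relative interior a generalized eigenvector of $A$ corresponding to $\lambda$ can be expressed as a join of semi-distinguished $A$-invariant faces associated with $\lambda$. Then conditions (b), (c) and (d) are equivalent. (iii) When $K$ is polyhedral, conditions (b), (c) and (d) are equivalent. If, in addition, $\lambda=\rho(A)$, then condition (a) is also another equivalent condition.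
   Context: A proper cone of $\mathbb{R}^n$ is a closed convex cone that is pointed ($K\cap(-K)=\{0\}$) and has nonempty interior; it is polyhedral if it has finitely many extreme rays. $\pi(K)$ is the set of real $n\times n$ matrices $A$ with $AK\subseteq K$; $\rho(A)$ is the spectral radius and $\mathcal{N}$ denotes (real) null space. A face of $K$ is a convex subcone $F\subseteq K$ such that $x,y\in K$, $x+y\in F$ imply $x,y\in F$; it is $A$-invariant if $AF\subseteq F$. The join $F\vee G$ is the smallest face of $K$ including $F\cup G$. Two faces are comparable if one is included in the other. A generalized eigenvector of $A$ corresponding to $\lambda$ is a nonzero $x$ with $(\lambda I-A)^kx=0$ for some positive integer $k$. A distinguished eigenvalue of $A$ for $K$ is an eigenvalue having an eigenvector in $K$. An $A$-invariant face is $A$-invariant join-irreducible if it is not the join of two $A$-invariant faces properly included in it. A semi-distinguished $A$-invariant face (associated with $\lambda$) is an $A$-invariant join-irreducible face containing in its relative interior a generalized eigenvector of $A$ (corresponding to $\lambda$). *)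

theory Defs
  imports "HOL-Analysis.Analysis"
begin

section \<open>Proper cones and their faces\<close>

definition proper_cone :: "(real ^ 'n) set \<Rightarrow> bool" where
  "proper_cone K \<longleftrightarrow>
     closed K \<and> convex_cone K \<and> K \<inter> uminus ` K = {0} \<and> interior K \<noteq> {}"

definition cone_preserving :: "(real ^ 'n) set \<Rightarrow> (real ^ 'n ^ 'n) set" where
  "cone_preserving K = {A. (*v) A ` K \<subseteq> K}"

text \<open>Since \<^const>\<open>convex_cone\<close> includes nonemptiness, the empty set is not a face, and
  \<open>{0}\<close> is the least face of a proper cone.\<close>

definition cone_face :: "(real ^ 'n) set \<Rightarrow> (real ^ 'n) set \<Rightarrow> bool" where
  "cone_face K F \<longleftrightarrow>
     convex_cone F \<and> F \<subseteq> K \<and> (\<forall>x\<in>K. \<forall>y\<in>K. x + y \<in> F \<longrightarrow> x \<in> F \<and> y \<in> F)"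

definition polyhedral_cone :: "(real ^ 'n) set \<Rightarrow> bool" where
  "polyhedral_cone K \<longleftrightarrow> finite {F. cone_face K F \<and> dim F = 1}"

text \<open>Faces are closed under intersection, so the intersection below is the smallest face
  of \<open>K\<close> including every member of the family.\<close>

definition join_faces :: "(real ^ 'n) set \<Rightarrow> (real ^ 'n) set set \<Rightarrow> (real ^ 'n) set" where
  "join_faces K \<F> = \<Inter>{H. cone_face K H \<and> \<Union>\<F> \<subseteq> H}"

abbreviation join_face :: "(real ^ 'n) set \<Rightarrow> (real ^ 'n) set \<Rightarrow> (real ^ 'n) set \<Rightarrow> (real ^ 'n) set"
  where "join_face K F G \<equiv> join_faces K {F, G}"


section \<open>Spectral notions\<close>

definition null_space :: "real ^ 'n ^ 'n \<Rightarrow> (real ^ 'n) set" where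
  "null_space M = {x. M *v x = 0}"

definition complex_matrix :: "real ^ 'n ^ 'n \<Rightarrow> complex ^ 'n ^ 'n" where
  "complex_matrix A = (\<chi> i j. complex_of_real (A $ i $ j))"

definition spectral_radius :: "real ^ 'n ^ 'n \<Rightarrow> real" where
  "spectral_radius A = Max {cmod \<mu> |\<mu>. \<exists>v. v \<noteq> 0 \<and> complex_matrix A *v v = \<mu> *s v}"

definition distinguished_eigenvalue :: "(real ^ 'n) set \<Rightarrow> real ^ 'n ^ 'n \<Rightarrow> real \<Rightarrow> bool" where
  "distinguished_eigenvalue K A lam \<longleftrightarrow> (\<exists>x\<in>K. x \<noteq> 0 \<and> A *v x = lam *\<^sub>R x)"

text \<open>Here \<open>mat lam\<close> is the scalar matrix \<open>lam I\<close>. A matrix power is expressed by iterating the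
  linear map, because \<open>^\<close> on the type of matrices is the entrywise power. It suffices to
  consider real \<open>lam\<close>: a nonzero real vector is never a generalized eigenvector for a
  nonreal eigenvalue of a real matrix.\<close>

definition generalized_eigenvector :: "real ^ 'n ^ 'n \<Rightarrow> real \<Rightarrow> real ^ 'n \<Rightarrow> bool" where
  "generalized_eigenvector A lam x \<longleftrightarrow>
     x \<noteq> 0 \<and> (\<exists>k>0. (((*v) (mat lam - A)) ^^ k) x = 0)"


section \<open>Invariant faces\<close>

definition invariant_face :: "(real ^ 'n) set \<Rightarrow> real ^ 'n ^ 'n \<Rightarrow> (real ^ 'n) set \<Rightarrow> bool" where
  "invariant_face K A F \<longleftrightarrow> cone_face K F \<and> (*v) A ` F \<subseteq> F"

definition invariant_join_irreducible ::
  "(real ^ 'n) set \<Rightarrow> real ^ 'n ^ 'n \<Rightarrow> (real ^ 'n) set \<Rightarrow> bool" where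
  "invariant_join_irreducible K A F \<longleftrightarrow> invariant_face K A F \<and>
     \<not> (\<exists>G H. invariant_face K A G \<and> invariant_face K A H \<and> G \<subset> F \<and> H \<subset> F \<and>
              F = join_face K G H)"

definition rel_interior_gen_eigvec ::
  "real ^ 'n ^ 'n \<Rightarrow> real \<Rightarrow> (real ^ 'n) set \<Rightarrow> bool" where
  "rel_interior_gen_eigvec A lam F \<longleftrightarrow> (\<exists>x\<in>rel_interior F. generalized_eigenvector A lam x)"

definition semi_distinguished_assoc ::
  "(real ^ 'n) set \<Rightarrow> real ^ 'n ^ 'n \<Rightarrow> real \<Rightarrow> (real ^ 'n) set \<Rightarrow> bool" where
  "semi_distinguished_assoc K A lam F \<longleftrightarrow>
     invariant_join_irreducible K A F \<and> rel_interior_gen_eigvec A lam F"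

definition semi_distinguished ::
  "(real ^ 'n) set \<Rightarrow> real ^ 'n ^ 'n \<Rightarrow> (real ^ 'n) set \<Rightarrow> bool" where
  "semi_distinguished K A F \<longleftrightarrow> (\<exists>lam. semi_distinguished_assoc K A lam F)"


section \<open>The five conditions\<close>

definition cond_a :: "real ^ 'n ^ 'n \<Rightarrow> real \<Rightarrow> bool" where
  "cond_a A lam \<longleftrightarrow> dim (null_space (mat lam - A)) = 1"

definition cond_b :: "(real ^ 'n) set \<Rightarrow> real ^ 'n ^ 'n \<Rightarrow> real \<Rightarrow> bool" where
  "cond_b K A lam \<longleftrightarrow>
     (\<forall>F. invariant_face K A F \<and> rel_interior_gen_eigvec A lam F \<longrightarrow> semi_distinguished K A F)"

definition cond_c :: "(real ^ 'n) set \<Rightarrow> real ^ 'n ^ 'n \<Rightarrow> real \<Rightarrow> bool" where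
  "cond_c K A lam \<longleftrightarrow>
     (\<forall>F G. invariant_face K A F \<and> rel_interior_gen_eigvec A lam F \<and>
            invariant_face K A G \<and> rel_interior_gen_eigvec A lam G \<longrightarrow> F \<subseteq> G \<or> G \<subseteq> F)"

definition cond_d :: "(real ^ 'n) set \<Rightarrow> real ^ 'n ^ 'n \<Rightarrow> real \<Rightarrow> bool" where
  "cond_d K A lam \<longleftrightarrow>
     (\<forall>F G. semi_distinguished_assoc K A lam F \<and> semi_distinguished_assoc K A lam G \<longrightarrow>
            F \<subseteq> G \<or> G \<subseteq> F)"

definition cond_e :: "(real ^ 'n) set \<Rightarrow> real ^ 'n ^ 'n \<Rightarrow> real \<Rightarrow> bool" where
  "cond_e K A lam \<longleftrightarrow> dim (span (null_space (mat lam - A) \<inter> K)) = 1"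

end

theory Submission
  imports Defs
begin

text \<open>A face of \<open>K\<close> is determined by any of its relative interior points \<open>x\<close>: it is
  \<open>Phi x = {v \<in> K. v \<le> c x for some c}\<close> in the order of \<open>K\<close>, the join of \<open>Phi x\<close> and \<open>Phi y\<close> is
  \<open>Phi (x + y)\<close>, and \<open>Phi x\<close> is invariant iff \<open>A x \<in> Phi x\<close>. All spectral information is extracted from
  the positive resolvent \<open>(\<mu> - A)\<^sup>-\<^sup>1 y\<close> as \<open>\<mu>\<close> decreases to \<open>\<lambda>\<close>. If \<open>x \<le> c (g + h)\<close> for a generalized
  eigenvector \<open>x\<close>, the pole of the resolvent of \<open>x\<close> must show up in that of \<open>g\<close> or \<open>h\<close>; with a single
  Jordan block this forces \<open>x\<close> into the span of \<open>Phi g\<close> or of \<open>Phi h\<close>, so (a) implies (b). For an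
  eigenvector \<open>x\<close>, limits of rescaled resolvents of \<open>g\<close> and \<open>h\<close> are eigenvectors whose faces still have
  join \<open>Phi x\<close>; an induction on dimension then gives (d) implies (e).

  For polyhedral \<open>K\<close> the quotients \<open>K / span F\<close> by faces are closed, so the same arguments apply modulo
  faces. Splitting \<open>x\<close> as above, but with generalized eigenvectors, gives (d) implies (b). If moreover
  \<open>\<lambda> = \<rho>(A)\<close>, the null space lies in the span of the largest face generated by a generalized
  eigenvector, and when these faces form a chain every null vector lies in the span of the
  smallest nonzero one, where it is unique up to scaling.\<close>

section \<open>Linear maps and cones\<close>

lemma linear_funpow:
  assumes "linear (f :: 'a::real_vector \<Rightarrow> 'a)"
  shows "linear (f ^^ k)"
proof (induction k)
  case 0
  then show ?case by (simp add: linear_id[unfolded id_def] id_def)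
next
  case (Suc k)
  then show ?case using assms linear_compose[of "f ^^ k" f] by (simp add: o_def)
qed

lemma funpow_in_subset:
  assumes "f ` V \<subseteq> V" "x \<in> V"
  shows "(f ^^ k) x \<in> V"
  using assms(2)
proof (induction k)
  case (Suc k)
  then show ?case using assms(1) by (simp add: image_subset_iff)
qed simp

lemma exists_linear_projection_along:
  fixes V :: "'a::euclidean_space set"
  assumes "subspace V"
  obtains Q :: "'a \<Rightarrow> 'a" where "linear Q" "\<And>x. Q x = 0 \<longleftrightarrow> x \<in> V" "\<And>x. x - Q x \<in> V"
proof -
  obtain B where B: "B \<subseteq> V" "independent B" "span B = V"
    using basis_exists[of V] assms by (metis span_subspace)
  obtain C where C: "B \<subseteq> C" "independent C" "span C = UNIV"
    using maximal_independent_subset_extend[OF subset_UNIV B(2)] by (metis UNIV_eq_I subsetD UNIV_I)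
  obtain Q where Q: "linear Q" "\<forall>x\<in>C. Q x = (if x \<in> B then 0 else x)"
    using linear_independent_extend[OF C(2), of "\<lambda>x. if x \<in> B then 0 else x"] by metis
  have diff: "x - Q x \<in> V" for x
  proof -
    have "x \<in> span C" using C by simp
    then show ?thesis
    proof (induction rule: span_induct)
      case base
      show ?case unfolding subspace_def mem_Collect_eq
      proof (intro conjI ballI allI)
        show "0 - Q 0 \<in> V" using assms Q by (simp add: linear_0 subspace_0)
      next
        fix x y assume "x \<in> {x. x - Q x \<in> V}" "y \<in> {x. x - Q x \<in> V}"
        then have "(x - Q x) + (y - Q y) \<in> V" using assms by (simp add: subspace_add)
        then show "x + y - Q (x + y) \<in> V" using Q by (simp add: linear_add algebra_simps)
      next
        fix c x assume "x \<in> {x. x - Q x \<in> V}"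
        then have "c *\<^sub>R (x - Q x) \<in> V" using assms by (simp add: subspace_scale)
        then show "c *\<^sub>R x - Q (c *\<^sub>R x) \<in> V"
          using Q by (simp add: linear_scale scaleR_diff_right)
      qed
    next
      case (step x)
      then show ?case using Q B assms by (auto simp: subspace_0)
    qed
  qed
  have "Q x = 0" if "x \<in> V" for x
  proof (rule linear_eq_0_on_span[OF Q(1)])
    show "Q b = 0" if "b \<in> B" for b using that Q(2) C(1) by auto
  qed (use that B in simp)
  moreover have "x \<in> V" if "Q x = 0" for x using diff[of x] that by simp
  ultimately show ?thesis using that Q(1) diff by blast
qed

lemma closed_pointed_cone_normal:
  fixes C :: "'a::euclidean_space set"
  assumes "closed C" "convex_cone C" and pointed: "\<And>x. x \<in> C \<Longrightarrow> - x \<in> C \<Longrightarrow> x = 0"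
  obtains \<kappa> where "\<kappa> > 0" "\<And>u v. u \<in> C \<Longrightarrow> v - u \<in> C \<Longrightarrow> norm u \<le> \<kappa> * norm v"
proof -
  define S where "S = uminus ` (C \<inter> sphere 0 1)"
  have S: "compact S" unfolding S_def
    using assms(1) by (intro compact_continuous_image continuous_intros) (auto simp: closed_Int_compact)
  show thesis
  proof (cases "S = {}")
    case True
    have "u = 0" if "u \<in> C" for u
    proof (rule ccontr)
      assume "u \<noteq> 0"
      then have "(1 / norm u) *\<^sub>R u \<in> C \<inter> sphere 0 1"
        using that assms(2) by (auto intro: convex_cone_scaleR)
      then show False using True by (auto simp: S_def)
    qed
    then have "norm u \<le> 1 * norm v" if "u \<in> C" for u v :: 'a using that by fastforce
    then show thesis using that[of 1] by simp
  next
    case False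
    have "S \<inter> C = {}" using pointed by (force simp: S_def)
    then have pos: "setdist S C > 0"
      using S assms False by (simp add: setdist_gt_0_compact_closed convex_cone_nonempty)
    show thesis
    proof (rule that[of "1 / setdist S C"])
      fix u v assume u: "u \<in> C" and v: "v - u \<in> C"
      show "norm u \<le> 1 / setdist S C * norm v"
      proof (cases "u = 0")
        case False
        have "(1 / norm u) *\<^sub>R u \<in> C \<inter> sphere 0 1"
          using u False assms(2) by (auto intro: convex_cone_scaleR)
        then have "- ((1 / norm u) *\<^sub>R u) \<in> S" unfolding S_def by blast
        moreover have "(1 / norm u) *\<^sub>R (v - u) \<in> C" using v assms(2) by (simp add: convex_cone_scaleR)
        ultimately have "setdist S C \<le> dist (- ((1 / norm u) *\<^sub>R u)) ((1 / norm u) *\<^sub>R (v - u))"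
          by (rule setdist_le_dist)
        also have "\<dots> = norm (- ((1 / norm u) *\<^sub>R v))"
          by (simp add: dist_norm algebra_simps)
        also have "\<dots> = norm v / norm u" by simp
        finally show ?thesis using pos False by (simp add: field_simps)
      qed (use pos in auto)
    qed (use pos in auto)
  qed
qed

lemma rel_interior_order_unit:
  fixes S :: "'a::euclidean_space set"
  assumes "convex_cone S" "g \<in> rel_interior S" "v \<in> S"
  obtains c where "c > 0" "c *\<^sub>R g - v \<in> S"
proof -
  have S: "convex S" "S \<noteq> {}" using assms(1) by (auto simp: convex_cone_def)
  obtain e where e: "e > 1" "(1 - e) *\<^sub>R v + e *\<^sub>R g \<in> S"
    using assms convex_rel_interior_iff[OF S] by blast
  then have "(1 / (e - 1)) *\<^sub>R ((1 - e) *\<^sub>R v + e *\<^sub>R g) \<in> S"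
    using assms(1) by (intro convex_cone_scaleR) auto
  also have "(1 / (e - 1)) *\<^sub>R ((1 - e) *\<^sub>R v + e *\<^sub>R g) = (e / (e - 1)) *\<^sub>R g - v"
  proof -
    have "(1 - e) / (e - 1) = - 1" using e(1) by (simp add: field_simps)
    then show ?thesis by (simp add: scaleR_add_right)
  qed
  finally show thesis using that[of "e / (e - 1)"] e(1) by simp
qed

lemma convex_cone_order_unit:
  fixes S :: "'a::euclidean_space set"
  assumes "convex_cone S"
  obtains g where "g \<in> S" "\<And>v. v \<in> S \<Longrightarrow> \<exists>c>0. c *\<^sub>R g - v \<in> S"
proof -
  obtain g where g: "g \<in> rel_interior S"
    using assms rel_interior_eq_empty[of S] by (auto simp: convex_cone_def)
  have "\<exists>c>0. c *\<^sub>R g - v \<in> S" if "v \<in> S" for v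
    using rel_interior_order_unit[OF assms g that] by blast
  then show thesis using that g rel_interior_subset by blast
qed

lemma unbounded_subsequence:
  fixes X :: "nat \<Rightarrow> 'a::real_normed_vector"
  assumes "\<not> bounded (range X)"
  obtains r where "strict_mono r" "\<And>n. norm (X (r n)) \<ge> real (Suc n)"
proof -
  have *: "\<exists>n>N. norm (X n) \<ge> M" for N M
  proof (rule ccontr)
    assume "\<not> ?thesis"
    then have "bounded (X ` {N<..})" by (auto intro!: boundedI[of _ M] simp: not_le less_imp_le)
    moreover have "bounded (X ` {..N})" by (intro finite_imp_bounded) auto
    moreover have "UNIV = {..N} \<union> {N<..}" by auto
    then have "range X = X ` {..N} \<union> X ` {N<..}" by (metis image_Un)
    ultimately show False using assms by (metis bounded_Un)
  qed
  have "\<exists>r. \<forall>n. norm (X (r n)) \<ge> real (Suc n) \<and> r n < r (Suc n)"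
    by (rule dependent_nat_choice) (use * in blast)+
  then show ?thesis using that by (auto simp: strict_mono_Suc_iff)
qed

text \<open>A blowing-up family of solutions of a resolvent equation yields, after normalisation, a
  null vector of the limiting map.\<close>

lemma unbounded_resolvent_imp_null_vector:
  fixes v :: "nat \<Rightarrow> 'a::euclidean_space"
  assumes "linear T" "closed C" "\<And>n. v n \<in> C" "conic C"
    and eq: "\<And>n. \<delta> n *\<^sub>R v n + T (v n) = y" and "\<delta> \<longlonglongrightarrow> 0" and unb: "\<not> bounded (range v)"
  obtains z where "z \<in> C" "z \<noteq> 0" "T z = 0"
proof -
  obtain r where r: "strict_mono r" "\<And>n. norm (v (r n)) \<ge> real (Suc n)"
    using unbounded_subsequence[OF unb] by blast
  define a where "a n = norm (v (r n))" for n
  have a: "a n > 0" "a n \<ge> real (Suc n)" for n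
    using r(2)[of n] by (auto simp: a_def simp del: of_nat_Suc intro: less_le_trans[of 0 "real (Suc n)"])
  define u where "u n = (1 / a n) *\<^sub>R v (r n)" for n
  have u: "norm (u n) = 1" "u n \<in> C" for n
    using a(1)[of n] assms(3)[of "r n"] assms(4) by (auto simp: u_def a_def conic_mul)
  have "u n \<in> C \<inter> sphere 0 1" for n using u by auto
  moreover have "compact (C \<inter> sphere 0 1)" using assms(2) by (simp add: closed_Int_compact)
  ultimately obtain z s where z: "z \<in> C \<inter> sphere 0 1" "strict_mono s" "(u \<circ> s) \<longlonglongrightarrow> z"
    unfolding compact_def by metis
  have T: "T (u n) = (1 / a n) *\<^sub>R y - \<delta> (r n) *\<^sub>R u n" for n
    using eq[of "r n", symmetric] assms(1) a(1)[of n]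
    by (simp add: u_def linear_scale algebra_simps)
  have "(\<lambda>n. (1 / a n) *\<^sub>R y) \<longlonglongrightarrow> 0 *\<^sub>R y"
  proof (intro tendsto_scaleR tendsto_const)
    show "(\<lambda>n. 1 / a n) \<longlonglongrightarrow> 0"
    proof (rule tendsto_sandwich[of "\<lambda>_. 0" _ _ "\<lambda>n. 1 / real (Suc n)"])
      show "(\<lambda>n. 1 / real (Suc n)) \<longlonglongrightarrow> 0"
        using LIMSEQ_inverse_real_of_nat by (simp add: inverse_eq_divide)
      show "\<forall>\<^sub>F n in sequentially. 1 / a n \<le> 1 / real (Suc n)"
        using a by (intro always_eventually allI divide_left_mono) (auto simp del: of_nat_Suc)
      show "\<forall>\<^sub>F n in sequentially. 0 \<le> 1 / a n"
        using a(1) by (intro always_eventually allI) (simp add: less_imp_le)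
    qed auto
  qed
  then have 1: "(\<lambda>n. (1 / a (s n)) *\<^sub>R y) \<longlonglongrightarrow> 0"
    using LIMSEQ_subseq_LIMSEQ[OF _ z(2)] by (force simp: o_def)
  have "(\<lambda>n. \<delta> (r (s n))) \<longlonglongrightarrow> 0"
    using LIMSEQ_subseq_LIMSEQ[OF LIMSEQ_subseq_LIMSEQ[OF assms(6) r(1)] z(2)] by (simp add: o_def)
  then have "(\<lambda>n. (1 / a (s n)) *\<^sub>R y - \<delta> (r (s n)) *\<^sub>R u (s n)) \<longlonglongrightarrow> 0 - 0 *\<^sub>R z"
    using z(3) 1 by (intro tendsto_diff tendsto_scaleR) (simp_all add: o_def)
  then have "(\<lambda>n. T (u (s n))) \<longlonglongrightarrow> 0" by (simp add: T)
  moreover have "(\<lambda>n. T (u (s n))) \<longlonglongrightarrow> T z"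
    using z(3) assms(1) by (intro bounded_linear.tendsto[of T]) (simp_all add: linear_conv_bounded_linear o_def)
  ultimately have "T z = 0" using LIMSEQ_unique by blast
  then show thesis using that[of z] z(1) by (cases "z = 0") auto
qed

lemma fitting_decomposition:
  fixes N :: "'a::euclidean_space \<Rightarrow> 'a"
  assumes N: "linear N" and V: "subspace V" "N ` V \<subseteq> V" and s: "s \<in> V"
  obtains a b k where "a \<in> V" "b \<in> V" "s = a + N b" "(N ^^ k) a = 0"
proof -
  define W where "W k = (N ^^ k) ` V" for k
  have sub: "subspace (W k)" for k
    unfolding W_def using V(1) linear_funpow[OF N] by (intro linear_subspace_image)
  have mono: "W (Suc k) \<subseteq> W k" for k
    using V(2) unfolding W_def funpow_Suc_right by (auto simp del: funpow.simps)
  obtain k where k: "\<And>j. dim (W k) \<le> dim (W j)"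
    using ex_has_least_nat[of "\<lambda>_. True" 0 "\<lambda>k. dim (W k)"] by blast
  have eq: "W (Suc k) = W k"
    using subspace_dim_equal[OF sub sub mono k] .
  have eqj: "W (j + k) = W k" for j
  proof (induction j)
    case (Suc j)
    have "W (Suc j + k) = N ` W (j + k)" by (auto simp: W_def image_image)
    also have "\<dots> = W (Suc k)" using Suc by (auto simp: W_def image_image)
    finally show ?case using eq by simp
  qed simp
  have "(N ^^ k) s \<in> W (Suc k + k)" using s eqj[of "Suc k"] by (auto simp: W_def)
  then obtain v where v: "v \<in> V" "(N ^^ k) s = (N ^^ (Suc k + k)) v" by (auto simp: W_def)
  define b where "b = (N ^^ k) v"
  have b: "b \<in> V" using v V(2) by (auto simp: b_def intro: funpow_in_subset)
  have "(N ^^ (Suc k + k)) v = (N ^^ k) (N b)"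
    unfolding b_def by (metis add.commute comp_apply funpow.simps(2) funpow_add)
  then have "(N ^^ k) (s - N b) = 0"
    using v linear_diff[OF linear_funpow[OF N]] by simp
  moreover have "s - N b \<in> V" using s b V by (auto intro: subspace_diff)
  ultimately show thesis using that[of "s - N b" b k] b by simp
qed

lemma convex_cone_conic: "convex_cone S \<Longrightarrow> conic S"
  by (simp add: convex_cone_def)

lemma dim_eq_1_iff_parallel:
  fixes S :: "'a::euclidean_space set"
  assumes "x \<in> S" "x \<noteq> 0"
  shows "dim S = 1 \<longleftrightarrow> (\<forall>u\<in>S. \<forall>v\<in>S. u \<noteq> 0 \<longrightarrow> (\<exists>\<alpha>. v = \<alpha> *\<^sub>R u))"
proof
  assume d: "dim S = 1"
  show "\<forall>u\<in>S. \<forall>v\<in>S. u \<noteq> 0 \<longrightarrow> (\<exists>\<alpha>. v = \<alpha> *\<^sub>R u)"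
  proof (intro ballI impI)
    fix u v assume uv: "u \<in> S" "v \<in> S" "u \<noteq> 0"
    then have "S \<subseteq> span {u}" using card_ge_dim_independent[of "{u}" S] d by simp
    then show "\<exists>\<alpha>. v = \<alpha> *\<^sub>R u" using uv by (auto simp: span_singleton)
  qed
next
  assume "\<forall>u\<in>S. \<forall>v\<in>S. u \<noteq> 0 \<longrightarrow> (\<exists>\<alpha>. v = \<alpha> *\<^sub>R u)"
  then have "S \<subseteq> span {x}" using assms unfolding span_singleton by blast
  moreover have "independent {x}" using assms by simp
  ultimately show "dim S = 1" using dim_unique[of "{x}" S 1] assms by simp
qed

lemma bounded_range_diff_iff:
  fixes A B C :: "nat \<Rightarrow> 'a::real_normed_vector"
  assumes "\<And>n. A n = B n - C n" "bounded (range B)"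
  shows "bounded (range A) \<longleftrightarrow> bounded (range C)"
proof -
  obtain b where b: "\<And>n. norm (B n) \<le> b" using assms(2) by (auto simp: bounded_iff)
  have A: "norm (A n) \<le> b + norm (C n)" "norm (C n) \<le> b + norm (A n)" for n
    using norm_triangle_ineq4[of "B n" "C n"] norm_triangle_ineq4[of "B n" "A n"] b[of n] assms(1)[of n]
    by auto
  show ?thesis
  proof
    assume "bounded (range A)"
    then obtain a where "\<And>n. norm (A n) \<le> a" by (auto simp: bounded_iff)
    then have "norm (C n) \<le> b + a" for n using A(2)[of n] by (metis add_left_mono order_trans)
    then show "bounded (range C)" by (auto simp: bounded_iff)
  next
    assume "bounded (range C)"
    then obtain a where "\<And>n. norm (C n) \<le> a" by (auto simp: bounded_iff)
    then have "norm (A n) \<le> b + a" for n using A(1)[of n] by (metis add_left_mono order_trans)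
    then show "bounded (range A)" by (auto simp: bounded_iff)
  qed
qed

section \<open>Eigenvalues and the spectral radius\<close>

lemma matrix_vector_mult_sum:
  "M *v (\<Sum>x\<in>S. g x) = (\<Sum>x\<in>S. M *v g x)" for M :: "'a::comm_semiring_1 ^ 'n ^ 'm"
  by (induction S rule: infinite_finite_induct) (auto simp: matrix_vector_right_distrib)

lemma eigenvectors_independent:
  fixes M :: "complex ^ 'n ^ 'n"
  assumes "finite S" "\<And>\<mu>. \<mu> \<in> S \<Longrightarrow> V \<mu> \<noteq> 0 \<and> M *v V \<mu> = \<mu> *s V \<mu>"
    and "(\<Sum>\<mu>\<in>S. c \<mu> *s V \<mu>) = 0" "\<mu> \<in> S"
  shows "c \<mu> = 0"
  using assms
proof (induction S arbitrary: c \<mu> rule: finite_induct)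
  case empty
  then show ?case by simp
next
  case (insert \<nu> S)
  have "0 = M *v (\<Sum>\<mu>\<in>insert \<nu> S. c \<mu> *s V \<mu>) - \<nu> *s (\<Sum>\<mu>\<in>insert \<nu> S. c \<mu> *s V \<mu>)"
    using insert.prems(2) by simp
  also have "\<dots> = (\<Sum>\<mu>\<in>insert \<nu> S. c \<mu> *s (\<mu> *s V \<mu>)) - (\<Sum>\<mu>\<in>insert \<nu> S. \<nu> *s (c \<mu> *s V \<mu>))"
    using insert.prems(1)
    unfolding matrix_vector_mult_sum vec.scale_sum_right
    by (intro arg_cong2[of _ _ _ _ "(-)"] sum.cong) (auto simp: vector_scalar_commute)
  also have "\<dots> = (\<Sum>\<mu>\<in>insert \<nu> S. (c \<mu> * (\<mu> - \<nu>)) *s V \<mu>)"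
    unfolding sum_subtractf[symmetric] by (intro sum.cong) (auto simp: vec_eq_iff algebra_simps)
  also have "\<dots> = (\<Sum>\<mu>\<in>S. (c \<mu> * (\<mu> - \<nu>)) *s V \<mu>)"
    using insert.hyps by simp
  finally have "c \<mu> * (\<mu> - \<nu>) = 0" if "\<mu> \<in> S" for \<mu>
    using insert.IH[of "\<lambda>\<mu>. c \<mu> * (\<mu> - \<nu>)" \<mu>] insert.prems(1) that by simp
  then have zero: "c \<mu> = 0" if "\<mu> \<in> S" for \<mu> using that insert.hyps by fastforce
  then have "(\<Sum>\<mu>\<in>S. c \<mu> *s V \<mu>) = 0" by (intro sum.neutral) simp
  then have "c \<nu> *s V \<nu> = 0" using insert.prems(2) insert.hyps by simp
  then have "c \<nu> = 0" using insert.prems(1)[of \<nu>] by simp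
  then show ?case using zero insert.prems(3) by blast
qed

lemma finite_eigenvalues:
  fixes M :: "complex ^ 'n ^ 'n"
  shows "finite {\<mu>. \<exists>v. v \<noteq> 0 \<and> M *v v = \<mu> *s v}" (is "finite ?E")
proof (rule ccontr)
  assume "infinite ?E"
  then obtain S where S: "finite S" "card S = DIM(complex ^ 'n) + 1" "S \<subseteq> ?E"
    using infinite_arbitrarily_large by blast
  define V where "V \<mu> = (SOME v. v \<noteq> 0 \<and> M *v v = \<mu> *s v)" for \<mu>
  have V: "V \<mu> \<noteq> 0 \<and> M *v V \<mu> = \<mu> *s V \<mu>" if "\<mu> \<in> S" for \<mu>
  proof -
    have "\<exists>v. v \<noteq> 0 \<and> M *v v = \<mu> *s v" using that S(3) by blast
    then show ?thesis unfolding V_def by (rule someI_ex)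
  qed
  have inj: "inj_on V S"
  proof (rule inj_onI)
    fix \<mu> \<nu> assume "\<mu> \<in> S" "\<nu> \<in> S" and eq: "V \<mu> = V \<nu>"
    have "\<mu> *s V \<mu> = \<nu> *s V \<mu>"
      using V[OF \<open>\<mu> \<in> S\<close>] V[OF \<open>\<nu> \<in> S\<close>] unfolding eq by simp
    then have "(\<mu> - \<nu>) *s V \<mu> = 0" by (simp add: vec.scale_left_diff_distrib)
    then show "\<mu> = \<nu>" using V[OF \<open>\<mu> \<in> S\<close>] by simp
  qed
  have "independent (V ` S)"
  proof
    assume "dependent (V ` S)"
    then obtain u where u: "\<exists>v\<in>V ` S. u v \<noteq> 0" "(\<Sum>v\<in>V ` S. u v *\<^sub>R v) = 0"
      using S(1) by (auto simp: dependent_finite)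
    have "(\<Sum>\<mu>\<in>S. complex_of_real (u (V \<mu>)) *s V \<mu>) = (\<Sum>v\<in>V ` S. u v *\<^sub>R v)"
      unfolding sum.reindex[OF inj] by (intro sum.cong) (auto simp: vec_eq_iff scaleR_conv_of_real[where 'a = complex])
    then have "complex_of_real (u (V \<mu>)) = 0" if "\<mu> \<in> S" for \<mu>
      using eigenvectors_independent[OF S(1) V, of "\<lambda>\<mu>. complex_of_real (u (V \<mu>))" \<mu>] u(2) that by simp
    then show False using u(1) by auto
  qed
  then have "card (V ` S) \<le> DIM(complex ^ 'n)" using independent_bound by blast
  then show False using S(2) card_image[OF inj] by simp
qed

lemma real_eigenvalue_le_spectral_radius:
  fixes A :: "real ^ 'n ^ 'n"
  assumes "A *v v = \<mu> *\<^sub>R v" "v \<noteq> 0"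
  shows "\<mu> \<le> spectral_radius A"
proof -
  define w :: "complex ^ 'n" where "w = (\<chi> i. complex_of_real (v $ i))"
  have "w \<noteq> 0" using assms(2) by (auto simp: w_def vec_eq_iff)
  moreover have "complex_matrix A *v w = complex_of_real \<mu> *s w"
  proof (subst vec_eq_iff, intro allI)
    fix i
    have "(complex_matrix A *v w) $ i = complex_of_real ((A *v v) $ i)"
      by (simp add: complex_matrix_def w_def matrix_vector_mult_def)
    then show "(complex_matrix A *v w) $ i = (complex_of_real \<mu> *s w) $ i"
      using assms(1) by (simp add: w_def)
  qed
  ultimately have "cmod (complex_of_real \<mu>) \<in> {cmod \<mu> |\<mu>. \<exists>v. v \<noteq> 0 \<and> complex_matrix A *v v = \<mu> *s v}"
    by blast
  moreover have "finite {cmod \<mu> |\<mu>. \<exists>v. v \<noteq> 0 \<and> complex_matrix A *v v = \<mu> *s v}"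
    using finite_imageI[OF finite_eigenvalues[of "complex_matrix A"], of cmod] by (simp add: setcompr_eq_image)
  ultimately have "cmod (complex_of_real \<mu>) \<le> spectral_radius A"
    unfolding spectral_radius_def by (intro Max_ge)
  then show ?thesis by simp
qed

section \<open>Cone-preserving maps and their resolvents\<close>

locale cone_map =
  fixes K :: "'a::euclidean_space set" and f :: "'a \<Rightarrow> 'a" and lam :: real
  assumes closed_K: "closed K" and cone_K: "convex_cone K"
    and pointed: "x \<in> K \<Longrightarrow> - x \<in> K \<Longrightarrow> x = 0"
    and linear_f: "linear f" and f_in_K: "x \<in> K \<Longrightarrow> f x \<in> K" and lam_nonneg: "0 \<le> lam"
begin

definition Phi :: "'a \<Rightarrow> 'a set" where
  "Phi x = {v \<in> K. \<exists>c\<ge>0. c *\<^sub>R x - v \<in> K}"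

definition N :: "'a \<Rightarrow> 'a" where
  "N v = lam *\<^sub>R v - f v"

text \<open>The zero vector is included here and in \<open>inv_gen\<close>, so that both are closed under addition.\<close>

definition gen :: "'a \<Rightarrow> bool" where
  "gen v \<longleftrightarrow> (\<exists>k. (N ^^ k) v = 0)"

definition inv_gen :: "'a set" where
  "inv_gen = {x \<in> K. f x \<in> Phi x \<and> gen x}"

definition res :: "real \<Rightarrow> 'a \<Rightarrow> 'a" where
  "res \<mu> y = (\<Sum>k. (1 / \<mu>) ^ Suc k *\<^sub>R (f ^^ k) y)"

definition res_summable :: "real \<Rightarrow> 'a \<Rightarrow> bool" where
  "res_summable \<mu> y \<longleftrightarrow> summable (\<lambda>k. (1 / \<mu>) ^ k * norm ((f ^^ k) y))"

lemma add_K: "x \<in> K \<Longrightarrow> y \<in> K \<Longrightarrow> x + y \<in> K"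
  using cone_K by (rule convex_cone_add)

lemma scale_K: "x \<in> K \<Longrightarrow> 0 \<le> c \<Longrightarrow> c *\<^sub>R x \<in> K"
  using cone_K by (simp add: convex_cone_scaleR)

lemma zero_K: "0 \<in> K"
  using cone_K by (rule convex_cone_contains_0)

lemma linear_N: "linear N"
  unfolding N_def using linear_f
  by (intro linear_compose_sub) (auto intro: linear_compose_scale_right)

lemma Phi_subset: "Phi x \<subseteq> K"
  by (auto simp: Phi_def)

lemma self_in_Phi: "x \<in> K \<Longrightarrow> x \<in> Phi x"
  by (auto simp: Phi_def zero_K intro: exI[of _ 1])

lemma Phi_trans:
  assumes "y \<in> Phi x" "z \<in> Phi y"
  shows "z \<in> Phi x"
proof -
  obtain c d where "c \<ge> 0" "c *\<^sub>R x - y \<in> K" "d \<ge> 0" "d *\<^sub>R y - z \<in> K" "z \<in> K"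
    using assms by (auto simp: Phi_def)
  moreover from this have "d *\<^sub>R (c *\<^sub>R x - y) + (d *\<^sub>R y - z) \<in> K" by (intro add_K scale_K)
  ultimately show ?thesis unfolding Phi_def
    by (auto intro!: exI[of _ "d * c"] simp: algebra_simps)
qed

lemma Phi_mono: "y \<in> Phi x \<Longrightarrow> Phi y \<subseteq> Phi x"
  using Phi_trans by blast

lemma convex_cone_Phi:
  assumes "x \<in> K"
  shows "convex_cone (Phi x)"
  unfolding convex_cone_iff
proof (intro conjI ballI allI impI)
  show "0 \<in> Phi x" using assms by (auto simp: Phi_def zero_K intro: exI[of _ 1])
next
  fix y z assume "y \<in> Phi x" "z \<in> Phi x"
  then obtain c d where "c \<ge> 0" "c *\<^sub>R x - y \<in> K" "d \<ge> 0" "d *\<^sub>R x - z \<in> K" "y \<in> K" "z \<in> K"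
    by (auto simp: Phi_def)
  moreover from this have "(c *\<^sub>R x - y) + (d *\<^sub>R x - z) \<in> K" by (intro add_K)
  ultimately show "y + z \<in> Phi x" unfolding Phi_def
    by (auto intro!: exI[of _ "c + d"] add_K simp: algebra_simps)
next
  fix y and c :: real assume "y \<in> Phi x" "c \<ge> 0"
  then obtain d where "d \<ge> 0" "d *\<^sub>R x - y \<in> K" "y \<in> K" by (auto simp: Phi_def)
  moreover from this \<open>c \<ge> 0\<close> have "c *\<^sub>R (d *\<^sub>R x - y) \<in> K" by (intro scale_K)
  ultimately show "c *\<^sub>R y \<in> Phi x" using \<open>c \<ge> 0\<close> unfolding Phi_def
    by (auto intro!: exI[of _ "c * d"] scale_K simp: algebra_simps)
qed

lemma add_Phi: "x \<in> K \<Longrightarrow> y \<in> Phi x \<Longrightarrow> z \<in> Phi x \<Longrightarrow> y + z \<in> Phi x"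
  using convex_cone_Phi convex_cone_add by blast

lemma scale_Phi: "x \<in> K \<Longrightarrow> y \<in> Phi x \<Longrightarrow> 0 \<le> c \<Longrightarrow> c *\<^sub>R y \<in> Phi x"
  using convex_cone_Phi convex_cone_scaleR by blast

lemma zero_Phi: "x \<in> K \<Longrightarrow> 0 \<in> Phi x"
  using convex_cone_Phi convex_cone_contains_0 by blast

lemma Phi_zero: "Phi 0 = {0}"
  using pointed zero_K by (auto simp: Phi_def)

lemma span_Phi_order_unit:
  assumes "x \<in> K" "v \<in> span (Phi x)"
  obtains c where "c \<ge> 0" "\<And>t. t \<ge> c \<Longrightarrow> t *\<^sub>R x - v \<in> K"
proof -
  have "\<exists>c\<ge>0. \<forall>t\<ge>c. t *\<^sub>R x - v \<in> K \<and> t *\<^sub>R x + v \<in> K"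
    using assms(2)
  proof (induction rule: span_induct_alt)
    case base
    then show ?case using assms by (auto intro: scale_K)
  next
    case (step a u w)
    obtain c where c: "c \<ge> 0" "\<And>t. t \<ge> c \<Longrightarrow> t *\<^sub>R x - w \<in> K \<and> t *\<^sub>R x + w \<in> K"
      using step.IH by blast
    obtain d where d: "d \<ge> 0" "d *\<^sub>R x - u \<in> K" "u \<in> K"
      using step.hyps by (auto simp: Phi_def)
    have "t *\<^sub>R x - (a *\<^sub>R u + w) \<in> K \<and> t *\<^sub>R x + (a *\<^sub>R u + w) \<in> K"
      if "t \<ge> c + \<bar>a\<bar> * d" for t
    proof -
      have 1: "(t - \<bar>a\<bar> * d) *\<^sub>R x - w \<in> K" "(t - \<bar>a\<bar> * d) *\<^sub>R x + w \<in> K"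
        using c(2)[of "t - \<bar>a\<bar> * d"] that by auto
      have "\<bar>a\<bar> *\<^sub>R (d *\<^sub>R x - u) \<in> K" "\<bar>a\<bar> *\<^sub>R u \<in> K" "(\<bar>a\<bar> * d) *\<^sub>R x \<in> K"
        using d assms by (auto intro: scale_K)
      then have "(\<bar>a\<bar> * d) *\<^sub>R x - \<bar>a\<bar> *\<^sub>R u \<in> K" "(\<bar>a\<bar> * d) *\<^sub>R x + \<bar>a\<bar> *\<^sub>R u \<in> K"
        by (auto simp: scaleR_diff_right intro: add_K)
      then have "(\<bar>a\<bar> * d) *\<^sub>R x - a *\<^sub>R u \<in> K" "(\<bar>a\<bar> * d) *\<^sub>R x + a *\<^sub>R u \<in> K"
        by (cases "a \<ge> 0"; simp)+
      then show ?thesis using add_K[OF _ 1(1)] add_K[OF _ 1(2)]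
        by (fastforce simp: algebra_simps)
    qed
    moreover have "c + \<bar>a\<bar> * d \<ge> 0" using c d by simp
    ultimately show ?case by blast
  qed
  then show thesis using that by blast
qed

lemma Phi_eq_span:
  assumes "x \<in> K"
  shows "Phi x = K \<inter> span (Phi x)"
proof
  show "Phi x \<subseteq> K \<inter> span (Phi x)" using Phi_subset span_superset by blast
  show "K \<inter> span (Phi x) \<subseteq> Phi x"
  proof
    fix v assume v: "v \<in> K \<inter> span (Phi x)"
    then obtain c where "c \<ge> 0" "\<And>t. t \<ge> c \<Longrightarrow> t *\<^sub>R x - v \<in> K"
      using span_Phi_order_unit[OF assms] by blast
    then show "v \<in> Phi x" using v unfolding Phi_def by blast
  qed
qed

lemma closed_Phi: "x \<in> K \<Longrightarrow> closed (Phi x)"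
  by (subst Phi_eq_span) (auto intro: closed_Int closed_K)

lemma Phi_psubset_dim:
  assumes "x \<in> K" "y \<in> K" "Phi x \<subset> Phi y"
  shows "dim (Phi x) < dim (Phi y)"
proof (rule ccontr)
  assume "\<not> ?thesis"
  then have "span (Phi x) = span (Phi y)"
    using assms dim_eq_span[of "Phi x" "Phi y"] by auto
  then have "Phi x = Phi y" using Phi_eq_span assms by metis
  then show False using assms(3) by simp
qed

lemma f_Phi:
  assumes "x \<in> K" "f x \<in> Phi x" "y \<in> Phi x"
  shows "f y \<in> Phi x"
proof -
  obtain c where "c \<ge> 0" "c *\<^sub>R x - y \<in> K" "y \<in> K" using assms by (auto simp: Phi_def)
  then have "c *\<^sub>R f x - f y \<in> K" "f y \<in> K"
    using f_in_K[of "c *\<^sub>R x - y"] f_in_K[of y] linear_f by (auto simp: linear_diff linear_scale)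
  then have "f y \<in> Phi (f x)" using \<open>c \<ge> 0\<close> by (auto simp: Phi_def)
  then show ?thesis using assms Phi_trans by blast
qed

lemma N_span_Phi:
  assumes "x \<in> K" "f x \<in> Phi x"
  shows "N ` span (Phi x) \<subseteq> span (Phi x)"
proof -
  have "f ` Phi x \<subseteq> Phi x" using f_Phi assms by blast
  then have "f ` span (Phi x) \<subseteq> span (Phi x)"
    using linear_f by (metis span_linear_image span_mono)
  then show ?thesis unfolding N_def by (auto intro: span_diff span_scale)
qed

lemma f_add_Phi:
  assumes "x \<in> K" "f x \<in> Phi x" "y \<in> K" "f y \<in> Phi y"
  shows "f (x + y) \<in> Phi (x + y)"
proof -
  have "x \<in> Phi (x + y)" "y \<in> Phi (x + y)"
    using assms by (auto simp: Phi_def intro: exI[of _ 1])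
  then have "f x \<in> Phi (x + y)" "f y \<in> Phi (x + y)" using assms Phi_trans by blast+
  then show ?thesis using linear_f add_Phi add_K assms by (simp add: linear_add)
qed

lemma eigen_f_Phi: "x \<in> K \<Longrightarrow> N x = 0 \<Longrightarrow> f x \<in> Phi x"
  using scale_Phi[OF _ self_in_Phi lam_nonneg, of x] by (simp add: N_def)

lemma gen_funpow_mono:
  assumes "(N ^^ k) v = 0" "k \<le> m"
  shows "(N ^^ m) v = 0"
proof -
  have "(N ^^ m) v = (N ^^ (m - k)) ((N ^^ k) v)"
    using assms(2) by (metis comp_apply funpow_add le_add_diff_inverse2)
  then show ?thesis using assms(1) linear_0[OF linear_funpow[OF linear_N]] by simp
qed

lemma gen_zero: "gen 0"
  unfolding gen_def by (metis funpow_0)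

lemma gen_add:
  assumes "gen u" "gen v"
  shows "gen (u + v)"
proof -
  obtain j k where "(N ^^ j) u = 0" "(N ^^ k) v = 0" using assms by (auto simp: gen_def)
  then have "(N ^^ (max j k)) u = 0" "(N ^^ (max j k)) v = 0" by (auto intro: gen_funpow_mono)
  then have "(N ^^ (max j k)) (u + v) = 0"
    using linear_add[OF linear_funpow[OF linear_N]] by simp
  then show ?thesis unfolding gen_def by blast
qed

lemma gen_scale: "gen v \<Longrightarrow> gen (c *\<^sub>R v)"
  using linear_scale[OF linear_funpow[OF linear_N]] unfolding gen_def by (metis scaleR_zero_right)

lemma gen_N_iff: "gen (N v) \<longleftrightarrow> gen v"
proof -
  have eq: "(N ^^ k) (N v) = (N ^^ Suc k) v" for k by (metis comp_apply funpow_Suc_right)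
  have "(N ^^ Suc k) v = 0" if "(N ^^ k) v = 0" for k
    using gen_funpow_mono[OF that, of "Suc k"] by simp
  then show ?thesis unfolding gen_def eq by blast
qed

lemma gen_f:
  assumes "gen v"
  shows "gen (f v)"
proof -
  have "gen (lam *\<^sub>R v + (- 1) *\<^sub>R N v)" using assms by (intro gen_add gen_scale) (simp_all add: gen_N_iff)
  then show ?thesis by (simp add: N_def)
qed

lemma inv_genD: "x \<in> inv_gen \<Longrightarrow> x \<in> K \<and> f x \<in> Phi x \<and> gen x"
  by (simp add: inv_gen_def)

lemma inv_gen_zero: "0 \<in> inv_gen"
  using linear_f by (simp add: inv_gen_def zero_K gen_zero zero_Phi linear_0)

lemma inv_gen_add: "x \<in> inv_gen \<Longrightarrow> y \<in> inv_gen \<Longrightarrow> x + y \<in> inv_gen"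
  unfolding inv_gen_def using f_add_Phi add_K gen_add by blast

lemma eigen_inv_gen: "x \<in> K \<Longrightarrow> N x = 0 \<Longrightarrow> x \<in> inv_gen"
  unfolding inv_gen_def gen_def using eigen_f_Phi by (auto intro!: exI[of _ 1])

lemma convex_cone_gen_Phi:
  assumes "x \<in> K"
  shows "convex_cone {v \<in> Phi x. gen v}"
  unfolding convex_cone_iff
  using assms by (auto intro: add_Phi scale_Phi zero_Phi gen_zero gen_add gen_scale)

lemma exists_max_inv_gen:
  assumes "x \<in> K" "f x \<in> Phi x"
  obtains g where "g \<in> inv_gen" "g \<in> Phi x" "\<And>v. v \<in> Phi x \<Longrightarrow> gen v \<Longrightarrow> v \<in> Phi g"
proof -
  obtain g where g: "g \<in> Phi x" "gen g"
    and u: "\<And>v. v \<in> Phi x \<Longrightarrow> gen v \<Longrightarrow> \<exists>c>0. c *\<^sub>R g - v \<in> Phi x"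
    using convex_cone_order_unit[OF convex_cone_gen_Phi[OF assms(1)]] by (metis (no_types, lifting) mem_Collect_eq)
  have max: "v \<in> Phi g" if "v \<in> Phi x" "gen v" for v
    using u[OF that] that Phi_subset unfolding Phi_def by (auto intro: less_imp_le)
  moreover have "g \<in> inv_gen"
    using g max[of "f g"] f_Phi[OF assms] gen_f Phi_subset by (auto simp: inv_gen_def)
  ultimately show thesis using that g by blast
qed

lemma normal_K:
  obtains \<kappa> where "\<kappa> > 0" "\<And>u v. u \<in> K \<Longrightarrow> v - u \<in> K \<Longrightarrow> norm u \<le> \<kappa> * norm v"
  using closed_pointed_cone_normal[OF closed_K cone_K pointed] by blast

lemma funpow_f_K: "x \<in> K \<Longrightarrow> (f ^^ k) x \<in> K"
  using funpow_in_subset[of f K x k] f_in_K by blast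

subsection \<open>The resolvent on vectors dominated by generalized eigenvectors\<close>

definition res_dom :: "'a set" where
  "res_dom = {y. \<forall>\<mu>>lam. res_summable \<mu> y}"

lemma linear_fk: "linear (f ^^ k)"
  using linear_f by (rule linear_funpow)

lemma res_domD:
  assumes "y \<in> res_dom" "\<mu> > lam"
  shows "summable (\<lambda>k. (1 / \<mu>) ^ Suc k *\<^sub>R (f ^^ k) y)"
proof (rule summable_norm_cancel)
  have "summable (\<lambda>k. (1 / \<mu>) * ((1 / \<mu>) ^ k * norm ((f ^^ k) y)))"
    using assms by (intro summable_mult) (auto simp: res_dom_def res_summable_def)
  moreover have "norm ((1 / \<mu>) ^ Suc k *\<^sub>R (f ^^ k) y) = (1 / \<mu>) * ((1 / \<mu>) ^ k * norm ((f ^^ k) y))" for k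
    using assms lam_nonneg by (simp add: power_abs)
  ultimately show "summable (\<lambda>k. norm ((1 / \<mu>) ^ Suc k *\<^sub>R (f ^^ k) y))" by simp
qed

lemma res_dom_add:
  assumes "y \<in> res_dom" "z \<in> res_dom"
  shows "y + z \<in> res_dom"
  unfolding res_dom_def res_summable_def mem_Collect_eq
proof (intro allI impI)
  fix \<mu> assume mu: "\<mu> > lam"
  have "summable (\<lambda>k. (1 / \<mu>) ^ k * norm ((f ^^ k) y) + (1 / \<mu>) ^ k * norm ((f ^^ k) z))"
    using assms mu by (intro summable_add) (auto simp: res_dom_def res_summable_def)
  moreover have "norm ((1 / \<mu>) ^ k * norm ((f ^^ k) (y + z)))
      \<le> (1 / \<mu>) ^ k * norm ((f ^^ k) y) + (1 / \<mu>) ^ k * norm ((f ^^ k) z)" for k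
    using norm_triangle_ineq[of "(f ^^ k) y" "(f ^^ k) z"] mu lam_nonneg
    by (simp add: linear_add[OF linear_fk] power_abs flip: distrib_left)
  ultimately show "summable (\<lambda>k. (1 / \<mu>) ^ k * norm ((f ^^ k) (y + z)))"
    by (rule summable_comparison_test'[where N=0])
qed

lemma res_dom_scale:
  assumes "y \<in> res_dom"
  shows "c *\<^sub>R y \<in> res_dom"
  unfolding res_dom_def res_summable_def mem_Collect_eq
proof (intro allI impI)
  fix \<mu> assume mu: "\<mu> > lam"
  have "summable (\<lambda>k. \<bar>c\<bar> * ((1 / \<mu>) ^ k * norm ((f ^^ k) y)))"
    using assms mu by (intro summable_mult) (auto simp: res_dom_def res_summable_def)
  then show "summable (\<lambda>k. (1 / \<mu>) ^ k * norm ((f ^^ k) (c *\<^sub>R y)))"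
    by (simp add: linear_scale[OF linear_fk] mult_ac)
qed

lemma res_dom_diff: "y \<in> res_dom \<Longrightarrow> z \<in> res_dom \<Longrightarrow> y - z \<in> res_dom"
  using res_dom_add[of y "(- 1) *\<^sub>R z"] res_dom_scale[of z "- 1"] by simp

lemma res_dom_f:
  assumes "y \<in> res_dom"
  shows "f y \<in> res_dom"
  unfolding res_dom_def res_summable_def mem_Collect_eq
proof (intro allI impI)
  fix \<mu> assume mu: "\<mu> > lam"
  have "summable (\<lambda>k. (1 / \<mu>) ^ Suc k * norm ((f ^^ Suc k) y))"
    using assms mu by (subst summable_Suc_iff) (auto simp: res_dom_def res_summable_def)
  then have "summable (\<lambda>k. \<mu> * ((1 / \<mu>) ^ Suc k * norm ((f ^^ Suc k) y)))"
    by (rule summable_mult)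
  moreover have "\<mu> * ((1 / \<mu>) ^ Suc k * norm ((f ^^ Suc k) y)) = (1 / \<mu>) ^ k * norm ((f ^^ k) (f y))" for k
    using mu lam_nonneg by (simp add: funpow_swap1)
  ultimately show "summable (\<lambda>k. (1 / \<mu>) ^ k * norm ((f ^^ k) (f y)))" by simp
qed

lemma res_dom_N: "y \<in> res_dom \<Longrightarrow> N y \<in> res_dom"
  unfolding N_def by (intro res_dom_diff res_dom_scale res_dom_f)

text \<open>With \<open>a k = \<parallel>f\<^sup>k y\<parallel> / \<mu>\<^sup>k\<close> the recursion \<open>a (k + 1) \<le> (lam / \<mu>) a k + b k\<close>, where \<open>b\<close> is
  summable, bounds the partial sums of \<open>a\<close>.\<close>

lemma res_dom_if_N:
  assumes "N y \<in> res_dom"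
  shows "y \<in> res_dom"
  unfolding res_dom_def res_summable_def mem_Collect_eq
proof (intro allI impI)
  fix \<mu> assume mu: "\<mu> > lam"
  define a where "a k = (1 / \<mu>) ^ k * norm ((f ^^ k) y)" for k
  define b where "b k = (1 / \<mu>) ^ k * norm ((f ^^ k) (N y)) / \<mu>" for k
  have mu0: "\<mu> > 0" using mu lam_nonneg by simp
  have b: "summable b" "b k \<ge> 0" and a0: "a k \<ge> 0" for k
    using assms mu mu0 unfolding b_def a_def
    by (auto simp: res_dom_def res_summable_def intro!: summable_divide)
  have rec: "a (Suc k) \<le> lam / \<mu> * a k + b k" for k
  proof -
    have "(f ^^ Suc k) y = (f ^^ k) (lam *\<^sub>R y - N y)" by (simp add: N_def funpow_swap1)
    also have "\<dots> = lam *\<^sub>R (f ^^ k) y - (f ^^ k) (N y)"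
      by (simp add: linear_diff[OF linear_fk] linear_scale[OF linear_fk])
    finally have "norm ((f ^^ Suc k) y) \<le> lam * norm ((f ^^ k) y) + norm ((f ^^ k) (N y))"
      using norm_triangle_ineq4[of "lam *\<^sub>R (f ^^ k) y" "(f ^^ k) (N y)"] lam_nonneg by simp
    then have "(1 / \<mu>) ^ Suc k * norm ((f ^^ Suc k) y)
        \<le> (1 / \<mu>) ^ Suc k * (lam * norm ((f ^^ k) y) + norm ((f ^^ k) (N y)))"
      using mu0 by (intro mult_left_mono) auto
    then show ?thesis using mu0 by (simp add: a_def b_def field_simps)
  qed
  have q: "0 < 1 - lam / \<mu>" using mu mu0 by (simp add: field_simps)
  have "(\<Sum>k<n. a k) \<le> (a 0 + suminf b) / (1 - lam / \<mu>)" for n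
  proof -
    have "(\<Sum>k<n. a k) \<le> (\<Sum>k<Suc n. a k)" using a0[of n] by simp
    also have "\<dots> = a 0 + (\<Sum>k<n. a (Suc k))" by (rule sum.lessThan_Suc_shift)
    also have "\<dots> \<le> a 0 + (\<Sum>k<n. lam / \<mu> * a k + b k)"
      using rec by (intro add_left_mono sum_mono) auto
    also have "\<dots> = a 0 + lam / \<mu> * (\<Sum>k<n. a k) + (\<Sum>k<n. b k)"
      by (simp add: sum.distrib sum_distrib_left)
    also have "\<dots> \<le> a 0 + lam / \<mu> * (\<Sum>k<n. a k) + suminf b"
      using sum_le_suminf[OF b(1)] b(2) by (intro add_left_mono) auto
    finally have "(1 - lam / \<mu>) * (\<Sum>k<n. a k) \<le> a 0 + suminf b" by (simp add: left_diff_distrib)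
    then show ?thesis using q by (simp add: pos_le_divide_eq mult.commute)
  qed
  then have "summable a" using a0 by (intro summableI_nonneg_bounded) auto
  then show "summable (\<lambda>k. (1 / \<mu>) ^ k * norm ((f ^^ k) y))" unfolding a_def .
qed

lemma gen_res_dom:
  assumes "gen y"
  shows "y \<in> res_dom"
proof -
  have zero: "0 \<in> res_dom"
    using linear_0[OF linear_fk] by (simp add: res_dom_def res_summable_def)
  have "y \<in> res_dom" if "(N ^^ k) y = 0" for k
    using that
  proof (induction k arbitrary: y)
    case (Suc k)
    then have "N y \<in> res_dom" by (metis comp_apply funpow_Suc_right)
    then show ?case by (rule res_dom_if_N)
  qed (use zero in simp)
  then show ?thesis using assms by (auto simp: gen_def)
qed

lemma Phi_res_dom:
  assumes "x \<in> K" "x \<in> res_dom" "y \<in> Phi x"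
  shows "y \<in> res_dom"
  unfolding res_dom_def res_summable_def mem_Collect_eq
proof (intro allI impI)
  fix \<mu> assume mu: "\<mu> > lam"
  obtain c where c: "c \<ge> 0" "c *\<^sub>R x - y \<in> K" "y \<in> K" using assms by (auto simp: Phi_def)
  obtain \<kappa> where k: "\<kappa> > 0" "\<And>u v. u \<in> K \<Longrightarrow> v - u \<in> K \<Longrightarrow> norm u \<le> \<kappa> * norm v"
    by (rule normal_K) (rule that)
  have "norm ((f ^^ k) y) \<le> \<kappa> * (c * norm ((f ^^ k) x))" for k
  proof -
    have "(f ^^ k) (c *\<^sub>R x - y) \<in> K" "(f ^^ k) y \<in> K" using c funpow_f_K by auto
    then show ?thesis using k(2)[of "(f ^^ k) y" "c *\<^sub>R (f ^^ k) x"] c(1)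
      by (simp add: linear_diff[OF linear_fk] linear_scale[OF linear_fk])
  qed
  then have le: "norm ((1 / \<mu>) ^ k * norm ((f ^^ k) y)) \<le> \<kappa> * c * ((1 / \<mu>) ^ k * norm ((f ^^ k) x))" for k
    using mu lam_nonneg by (simp add: divide_right_mono power_abs mult.assoc)
  have "summable (\<lambda>k. \<kappa> * c * ((1 / \<mu>) ^ k * norm ((f ^^ k) x)))"
    using assms mu by (intro summable_mult) (auto simp: res_dom_def res_summable_def)
  then show "summable (\<lambda>k. (1 / \<mu>) ^ k * norm ((f ^^ k) y))"
    using le by (rule summable_comparison_test'[where N=0])
qed

lemma res_add:
  assumes "y \<in> res_dom" "z \<in> res_dom" "\<mu> > lam"
  shows "res \<mu> (y + z) = res \<mu> y + res \<mu> z"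
  unfolding res_def suminf_add[OF res_domD[OF assms(1,3)] res_domD[OF assms(2,3)]]
    linear_add[OF linear_fk] scaleR_add_right ..

lemma res_scale:
  assumes "y \<in> res_dom" "\<mu> > lam"
  shows "res \<mu> (c *\<^sub>R y) = c *\<^sub>R res \<mu> y"
  unfolding res_def suminf_scaleR_right[OF res_domD[OF assms]]
    linear_scale[OF linear_fk] scaleR_left_commute[of c] ..

lemma res_diff:
  assumes "y \<in> res_dom" "z \<in> res_dom" "\<mu> > lam"
  shows "res \<mu> (y - z) = res \<mu> y - res \<mu> z"
  using res_add[OF assms(1) res_dom_scale[OF assms(2)] assms(3), of "- 1"]
  unfolding res_scale[OF assms(2,3)] by simp

lemma f_res:
  assumes "y \<in> res_dom" "\<mu> > lam"
  shows "f (res \<mu> y) = res \<mu> (f y)"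
proof -
  have "f (res \<mu> y) = (\<Sum>k. f ((1 / \<mu>) ^ Suc k *\<^sub>R (f ^^ k) y))"
    unfolding res_def using linear_f assms
    by (intro bounded_linear.suminf res_domD) (simp_all add: linear_conv_bounded_linear)
  also have "\<dots> = res \<mu> (f y)"
    unfolding res_def using linear_f by (simp add: linear_scale funpow_swap1 del: power_Suc)
  finally show ?thesis .
qed

lemma res_eq:
  assumes "y \<in> res_dom" "\<mu> > lam"
  shows "\<mu> *\<^sub>R res \<mu> y - f (res \<mu> y) = y"
proof -
  have mu: "\<mu> \<noteq> 0" using assms lam_nonneg by auto
  have s: "summable (\<lambda>k. (1 / \<mu>) ^ Suc k *\<^sub>R (f ^^ k) y)" using res_domD assms by blast
  have eq: "\<mu> *\<^sub>R ((1 / \<mu>) ^ Suc k *\<^sub>R (f ^^ k) y) = (1 / \<mu>) ^ k *\<^sub>R (f ^^ k) y" for k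
    using mu by simp
  have s': "summable (\<lambda>k. (1 / \<mu>) ^ k *\<^sub>R (f ^^ k) y)"
    using summable_scaleR_right[OF s, of \<mu>] unfolding eq .
  have "\<mu> *\<^sub>R res \<mu> y = (\<Sum>k. (1 / \<mu>) ^ k *\<^sub>R (f ^^ k) y)"
    unfolding res_def using suminf_scaleR_right[OF s, of \<mu>] unfolding eq by simp
  also have "\<dots> = y + (\<Sum>k. (1 / \<mu>) ^ Suc k *\<^sub>R (f ^^ Suc k) y)"
    using suminf_split_head[OF s'] by (simp del: power_Suc funpow.simps(2))
  also have "(\<Sum>k. (1 / \<mu>) ^ Suc k *\<^sub>R (f ^^ Suc k) y) = f (res \<mu> y)"
    unfolding f_res[OF assms] unfolding res_def by (simp add: funpow_swap1 del: power_Suc)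
  finally show ?thesis by simp
qed

lemma N_res:
  assumes "y \<in> res_dom" "\<mu> > lam"
  shows "N (res \<mu> y) = res \<mu> (N y)"
  unfolding N_def f_res[OF assms] res_diff[OF res_dom_scale[OF assms(1)] res_dom_f[OF assms(1)] assms(2)]
    res_scale[OF assms] ..

lemma Nk_res:
  assumes "y \<in> res_dom" "\<mu> > lam"
  shows "(N ^^ k) y \<in> res_dom \<and> (N ^^ k) (res \<mu> y) = res \<mu> ((N ^^ k) y)"
  using assms by (induction k) (auto simp: N_res res_dom_N)

lemma res_in_cone:
  assumes "y \<in> res_dom" "\<mu> > lam" "closed C" "convex_cone C" "f ` C \<subseteq> C" "y \<in> C"
  shows "res \<mu> y \<in> C"
proof -
  have fk: "(f ^^ k) y \<in> C" for k using funpow_in_subset[OF assms(5,6)] .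
  have "(\<Sum>k<n. (1 / \<mu>) ^ Suc k *\<^sub>R (f ^^ k) y) \<in> C" for n
  proof (induction n)
    case 0
    then show ?case using assms by (simp add: convex_cone_contains_0)
  next
    case (Suc n)
    have "(1 / \<mu>) ^ Suc n *\<^sub>R (f ^^ n) y \<in> C"
      using assms(2,4) lam_nonneg fk by (intro convex_cone_scaleR) auto
    then show ?case using Suc assms(4) by (simp add: convex_cone_add del: power_Suc)
  qed
  moreover have "(\<lambda>n. \<Sum>k<n. (1 / \<mu>) ^ Suc k *\<^sub>R (f ^^ k) y) \<longlonglongrightarrow> res \<mu> y"
    unfolding res_def using res_domD[OF assms(1,2)] by (rule summable_LIMSEQ)
  ultimately show ?thesis by (rule closed_sequentially[OF assms(3)])
qed

lemma res_in_K: "y \<in> res_dom \<Longrightarrow> \<mu> > lam \<Longrightarrow> y \<in> K \<Longrightarrow> res \<mu> y \<in> K"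
  using res_in_cone[OF _ _ closed_K cone_K] f_in_K by blast

lemma res_in_Phi:
  assumes "y \<in> res_dom" "\<mu> > lam" "x \<in> K" "f x \<in> Phi x" "y \<in> Phi x"
  shows "res \<mu> y \<in> Phi x"
  using assms by (intro res_in_cone closed_Phi convex_cone_Phi) (auto intro: f_Phi)

lemma res_in_subspace:
  assumes "y \<in> res_dom" "\<mu> > lam" "subspace V" "f ` V \<subseteq> V" "y \<in> V"
  shows "res \<mu> y \<in> V"
  using assms by (intro res_in_cone closed_subspace)
    (auto simp: convex_cone_iff subspace_0 subspace_add subspace_scale)

definition step :: "nat \<Rightarrow> real" where
  "step n = inverse (real (Suc n))"

lemma step_pos: "step n > 0"
  by (simp add: step_def del: of_nat_Suc)

lemma step_tendsto: "step \<longlonglongrightarrow> 0"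
  unfolding step_def using LIMSEQ_inverse_real_of_nat by simp

abbreviation R :: "'a \<Rightarrow> nat \<Rightarrow> 'a" where
  "R y n \<equiv> res (lam + step n) y"

lemma R_eq: "y \<in> res_dom \<Longrightarrow> step n *\<^sub>R R y n + N (R y n) = y"
  using res_eq[of y "lam + step n"] step_pos[of n] by (simp add: N_def algebra_simps)

lemma f_subset_if_N_subset:
  assumes "subspace V" "N ` V \<subseteq> V"
  shows "f ` V \<subseteq> V"
proof
  fix y assume "y \<in> f ` V"
  then obtain v where v: "v \<in> V" "y = f v" by blast
  then have "lam *\<^sub>R v - N v \<in> V" using assms by (auto intro!: subspace_diff subspace_scale)
  then show "y \<in> V" using v by (simp add: N_def)
qed

text \<open>If \<open>N\<^sup>q\<^sup>+\<^sup>1\<close> sends \<open>x\<close> into \<open>V\<close> but \<open>N\<^sup>q\<close> does not, then \<open>N\<^sup>q\<close> of the resolvent of \<open>x\<close> has a pole of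
  order one modulo \<open>V\<close>.\<close>

lemma R_unbounded_mod:
  assumes "gen x" "subspace V" "N ` V \<subseteq> V" "x \<notin> V"
    and Q: "linear Q" "\<And>v. Q v = 0 \<longleftrightarrow> v \<in> V" "\<And>v. v - Q v \<in> V"
  shows "\<not> bounded (range (\<lambda>n. Q (R x n)))"
proof
  assume bdd: "bounded (range (\<lambda>n. Q (R x n)))"
  obtain m where "(N ^^ m) x = 0" using assms(1) by (auto simp: gen_def)
  then have ex: "\<exists>p. (N ^^ p) x \<in> V" using assms(2) by (metis subspace_0)
  define p where "p = (LEAST p. (N ^^ p) x \<in> V)"
  have p: "(N ^^ p) x \<in> V" using LeastI_ex[OF ex] by (simp add: p_def)
  have "p \<noteq> 0" using p assms(4) by (metis funpow_0)
  then obtain q where q: "p = Suc q" using not0_implies_Suc by blast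
  have nq: "(N ^^ q) x \<notin> V" using not_less_Least[of q] q unfolding p_def by force
  have x: "x \<in> res_dom" using gen_res_dom assms(1) by blast
  have mu: "lam + step n > lam" for n using step_pos by simp
  define T where "T = Q \<circ> (N ^^ q)"
  have T: "bounded_linear T" unfolding T_def
    using linear_compose[OF linear_funpow[OF linear_N] Q(1)] by (simp add: linear_conv_bounded_linear)
  have "bounded (T ` range (\<lambda>n. Q (R x n)))"
    using bdd T by (rule bounded_linear_image)
  then obtain B where B: "\<And>n. norm (T (Q (R x n))) \<le> B" by (auto simp: bounded_iff)
  have 1: "T (Q (R x n)) = Q ((N ^^ q) (R x n))" for n
  proof -
    have "(N ^^ q) (R x n - Q (R x n)) \<in> V" using funpow_in_subset[OF assms(3) Q(3)] .
    then have "T (R x n - Q (R x n)) = 0" using Q(2) by (simp add: T_def)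
    then have "T (R x n) = T (Q (R x n))"
      using T by (simp add: bounded_linear.linear linear_diff)
    then show ?thesis by (simp add: T_def)
  qed
  have 2: "step n *\<^sub>R Q ((N ^^ q) (R x n)) = Q ((N ^^ q) x)" for n
  proof -
    have "(N ^^ p) (R x n) = R ((N ^^ p) x) n" using Nk_res[OF x mu] by simp
    also have "\<dots> \<in> V"
      using Nk_res[OF x mu] p by (intro res_in_subspace mu assms f_subset_if_N_subset) auto
    finally have z: "Q (N ((N ^^ q) (R x n))) = 0" using Q(2) by (simp add: q)
    have "step n *\<^sub>R (N ^^ q) (R x n) + N ((N ^^ q) (R x n)) = (N ^^ q) x"
      using R_eq[of "(N ^^ q) x" n] Nk_res[OF x mu, of q] by simp
    then have "Q (step n *\<^sub>R (N ^^ q) (R x n) + N ((N ^^ q) (R x n))) = Q ((N ^^ q) x)" by simp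
    then show ?thesis using z Q(1) by (simp add: linear_add linear_scale)
  qed
  have "norm (Q ((N ^^ q) x)) \<le> step n * B" for n
    using B[of n] step_pos[of n] unfolding 2[of n, symmetric] 1 by (simp add: mult_left_mono)
  moreover have "(\<lambda>n. step n * B) \<longlonglongrightarrow> 0 * B" by (intro tendsto_mult step_tendsto tendsto_const)
  ultimately have "norm (Q ((N ^^ q) x)) \<le> 0"
    by (intro tendsto_lowerbound[of "\<lambda>n. step n * B" 0 sequentially]) auto
  then show False using nq Q(2) by simp
qed

subsection \<open>Resolvents modulo a face\<close>

text \<open>A vector of a face that is an eigenvector modulo a smaller invariant face can be corrected, by
  Fitting's decomposition and a large multiple of the order unit, to a generalized eigenvector.\<close>

lemma eigen_mod_imp_gen:
  assumes "h \<in> K" "g \<in> inv_gen" "g \<in> Phi h" "z \<in> Phi h" "z \<notin> Phi g" "N z \<in> span (Phi g)"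
  obtains w where "w \<in> Phi h" "w \<notin> Phi g" "gen w" "N w \<in> span (Phi g)"
proof -
  have g: "g \<in> K" "f g \<in> Phi g" "gen g" using inv_genD[OF assms(2)] by auto
  let ?V = "span (Phi g)"
  have V: "N ` ?V \<subseteq> ?V" by (rule N_span_Phi[OF g(1,2)])
  obtain a b k where ab: "a \<in> ?V" "b \<in> ?V" "N z = a + N b" "(N ^^ k) a = 0"
    using fitting_decomposition[OF linear_N subspace_span V assms(6)] by metis
  have "N (z - b) = a" using ab linear_diff[OF linear_N] by simp
  then have gz: "gen (z - b)" using ab(4) gen_N_iff by (metis gen_def)
  obtain c where c: "c \<ge> 0" "\<And>t. t \<ge> c \<Longrightarrow> t *\<^sub>R g - b \<in> K"
    using span_Phi_order_unit[OF g(1) ab(2)] by blast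
  have cg: "c *\<^sub>R g - b \<in> ?V" using ab(2) self_in_Phi[OF g(1)]
    by (intro span_diff span_scale) (auto intro: span_base)
  then have cgP: "c *\<^sub>R g - b \<in> Phi g" using c(2)[of c] Phi_eq_span[OF g(1)] by blast
  define w where "w = z + (c *\<^sub>R g - b)"
  have "w \<in> Phi h" unfolding w_def
    using cgP Phi_mono[OF assms(3)] assms by (intro add_Phi) auto
  moreover have "w \<notin> Phi g"
  proof
    assume "w \<in> Phi g"
    then have "w - (c *\<^sub>R g - b) \<in> ?V" by (intro span_diff[OF span_base cg])
    then have "z \<in> ?V" by (simp add: w_def)
    then show False using assms Phi_eq_span[OF g(1)] Phi_subset by blast
  qed
  moreover have "gen w"
    using gen_add[OF gz gen_scale[OF g(3), of c]] by (simp add: w_def algebra_simps)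
  moreover have "N w \<in> ?V"
    unfolding w_def linear_add[OF linear_N] using assms(6) V cg by (intro span_add) auto
  ultimately show thesis using that by blast
qed

lemma closed_image_Phi:
  fixes Q :: "'a \<Rightarrow> 'a"
  assumes Q: "linear Q" "\<And>v. Q v = 0 \<longleftrightarrow> v \<in> span (Phi g)" and "closed (Q ` K)"
    and "h \<in> K" "g \<in> K" "g \<in> Phi h"
  shows "closed (Q ` Phi h)"
proof -
  have "Q ` Phi h = Q ` K \<inter> Q ` span (Phi h)"
  proof
    show "Q ` Phi h \<subseteq> Q ` K \<inter> Q ` span (Phi h)" using Phi_subset by (auto intro: span_base)
    show "Q ` K \<inter> Q ` span (Phi h) \<subseteq> Q ` Phi h"
    proof
      fix u assume "u \<in> Q ` K \<inter> Q ` span (Phi h)"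
      then obtain k v where kv: "k \<in> K" "u = Q k" "v \<in> span (Phi h)" "Q k = Q v" by auto
      then have "Q (k - v) = 0" using linear_diff[OF Q(1)] by simp
      then have "k - v \<in> span (Phi g)" using Q(2) by blast
      then have "k - v \<in> span (Phi h)" using span_mono[OF Phi_mono[OF assms(6)]] by blast
      then have "k \<in> span (Phi h)" using kv(3) span_add[of "k - v" "Phi h" v] by simp
      then show "u \<in> Q ` Phi h" using kv Phi_eq_span[OF assms(4)] by blast
    qed
  qed
  moreover have "closed (Q ` span (Phi h))"
    by (rule closed_subspace[OF linear_subspace_image[OF Q(1) subspace_span]])
  ultimately show ?thesis using assms(3) by auto
qed

lemma resolvent_bounded_mod:
  assumes "h \<in> K" "g \<in> inv_gen" "g \<in> Phi h"
    and max: "\<And>v. v \<in> Phi h \<Longrightarrow> gen v \<Longrightarrow> N v \<in> span (Phi g) \<Longrightarrow> v \<in> Phi g"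
    and Q: "linear Q" "\<And>v. Q v = 0 \<longleftrightarrow> v \<in> span (Phi g)" "\<And>v. v - Q v \<in> span (Phi g)"
    and "closed (Q ` K)"
    and w: "\<And>n. w n \<in> Phi h" "\<And>n. step n *\<^sub>R w n + N (w n) = y"
  shows "bounded (range (\<lambda>n. Q (w n)))"
proof (rule ccontr)
  assume unb: "\<not> ?thesis"
  have g: "g \<in> K" "f g \<in> Phi g" "gen g" using inv_genD[OF assms(2)] by auto
  have QNQ: "Q (N (Q v)) = Q (N v)" for v
  proof -
    have "N (v - Q v) \<in> span (Phi g)" using N_span_Phi[OF g(1,2)] Q(3)[of v] by blast
    then have "Q (N (v - Q v)) = 0" using Q(2) by blast
    then show ?thesis using linear_diff[OF linear_N] linear_diff[OF Q(1)] by simp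
  qed
  have lin: "linear (Q \<circ> N)" using linear_compose[OF linear_N Q(1)] .
  have "conic (Q ` Phi h)"
    using convex_cone_linear_image convex_cone_Phi[OF assms(1)] Q(1) convex_cone_conic by blast
  moreover have "step n *\<^sub>R Q (w n) + (Q \<circ> N) (Q (w n)) = Q y" for n
  proof -
    have "Q (step n *\<^sub>R w n + N (w n)) = Q y" using w(2) by simp
    then show ?thesis using QNQ Q(1) by (simp add: linear_add linear_scale)
  qed
  ultimately obtain z where z: "z \<in> Q ` Phi h" "z \<noteq> 0" "(Q \<circ> N) z = 0"
    using unbounded_resolvent_imp_null_vector[OF lin
        closed_image_Phi[OF Q(1,2) assms(8,1) g(1) assms(3)] _ _ _ step_tendsto unb] w(1) by blast
  then obtain v where v: "v \<in> Phi h" "z = Q v" by blast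
  have "v \<notin> Phi g" using v z Q(2) by (auto intro: span_base)
  moreover have "N v \<in> span (Phi g)" using z(3) QNQ Q(2) v by auto
  ultimately show False using eigen_mod_imp_gen[OF assms(1-3) v(1)] max by metis
qed

lemma normal_image_mod:
  fixes Q :: "'a \<Rightarrow> 'a"
  assumes "g \<in> K" and Q: "linear Q" "\<And>v. Q v = 0 \<longleftrightarrow> v \<in> span (Phi g)" and "closed (Q ` K)"
  obtains \<kappa> where "\<kappa> > 0" "\<And>u v. u \<in> K \<Longrightarrow> v - u \<in> K \<Longrightarrow> norm (Q u) \<le> \<kappa> * norm (Q v)"
proof -
  have pt: "x = 0" if "x \<in> Q ` K" "- x \<in> Q ` K" for x
  proof -
    obtain u v where uv: "u \<in> K" "v \<in> K" "x = Q u" "- x = Q v" using \<open>x \<in> Q ` K\<close> \<open>- x \<in> Q ` K\<close> by blast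
    then have "Q (u + v) = x + - x" using linear_add[OF Q(1)] by simp
    then have "Q (u + v) = 0" by simp
    then have "u + v \<in> Phi g" using Q(2) add_K uv Phi_eq_span[OF assms(1)] by blast
    moreover have "u \<in> Phi (u + v)" using uv by (auto simp: Phi_def intro: exI[of _ 1])
    ultimately have "u \<in> Phi g" using Phi_trans by blast
    then show "x = 0" using uv Q(2) by (auto intro: span_base)
  qed
  obtain \<kappa> where k: "\<kappa> > 0" "\<And>u v. u \<in> Q ` K \<Longrightarrow> v - u \<in> Q ` K \<Longrightarrow> norm u \<le> \<kappa> * norm v"
    using closed_pointed_cone_normal[OF assms(4) _ pt] convex_cone_linear_image cone_K Q(1) by metis
  have "norm (Q u) \<le> \<kappa> * norm (Q v)" if "u \<in> K" "v - u \<in> K" for u v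
    using k(2)[of "Q u" "Q v"] that linear_diff[OF Q(1), of v u] by (metis imageI)
  then show thesis using that k(1) by blast
qed

definition closed_quotients :: bool where
  "closed_quotients \<longleftrightarrow> (\<forall>Q::'a \<Rightarrow> 'a. linear Q \<longrightarrow> closed (Q ` K))"

lemma exists_mod_projection:
  obtains Q :: "'a \<Rightarrow> 'a" where "linear Q" "\<And>x. Q x = 0 \<longleftrightarrow> x \<in> span (Phi g)" "\<And>x. x - Q x \<in> span (Phi g)"
  using exists_linear_projection_along[OF subspace_span] by metis

lemma bounded_mod_mono:
  fixes Q P :: "'a \<Rightarrow> 'a"
  assumes "linear Q" "linear P" "span (Phi g) \<subseteq> span (Phi e)" "\<And>v. P v = 0 \<longleftrightarrow> v \<in> span (Phi e)"
    "\<And>v. v - Q v \<in> span (Phi g)" "bounded (range (\<lambda>n. Q (w n)))"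
  shows "bounded (range (\<lambda>n. P (w n)))"
proof -
  have "P (w n) = P (Q (w n))" for n
  proof -
    have "P (w n - Q (w n)) = 0" using assms(3-5) by blast
    then show ?thesis using linear_diff[OF assms(2)] by simp
  qed
  moreover have "bounded (P ` range (\<lambda>n. Q (w n)))"
    by (rule bounded_linear_image[OF assms(6) linear_conv_bounded_linear[THEN iffD1, OF assms(2)]])
  ultimately show ?thesis by (simp add: image_image)
qed

lemma exists_eigen_mod:
  assumes "closed_quotients" "x \<in> inv_gen" "g \<in> inv_gen" "g \<in> Phi x" "x \<notin> Phi g"
  obtains p where "p \<in> Phi x" "p \<notin> Phi g" "gen p" "N p \<in> span (Phi g)"
proof (rule ccontr)
  assume no: "\<not> thesis"
  have x: "x \<in> K" "f x \<in> Phi x" "gen x" and g: "g \<in> K" "f g \<in> Phi g" using inv_genD assms by auto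
  obtain Q where Q: "linear Q" "\<And>v. Q v = 0 \<longleftrightarrow> v \<in> span (Phi g)" "\<And>v. v - Q v \<in> span (Phi g)"
    using exists_mod_projection by metis
  have xd: "x \<in> res_dom" using gen_res_dom x by blast
  have "x \<notin> span (Phi g)" using assms(5) x Phi_eq_span[OF g(1)] by blast
  then have "\<not> bounded (range (\<lambda>n. Q (R x n)))"
    by (intro R_unbounded_mod[OF x(3) subspace_span N_span_Phi[OF g] _ Q])
  moreover have "bounded (range (\<lambda>n. Q (R x n)))"
  proof (rule resolvent_bounded_mod[OF x(1) assms(3,4) _ Q])
    show "R x n \<in> Phi x" for n
      using step_pos by (intro res_in_Phi[OF xd _ x(1,2)] self_in_Phi x) simp
  qed (use no that R_eq[OF xd] assms(1) Q in \<open>auto simp: closed_quotients_def\<close>)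
  ultimately show False by blast
qed

lemma split_gen_polyhedral:
  assumes "closed_quotients" and x: "x \<in> inv_gen"
    and g: "g \<in> Phi x" "f g \<in> Phi g" and h: "h \<in> Phi x" "f h \<in> Phi h" and xgh: "x \<in> Phi (g + h)"
  obtains u v where "u \<in> inv_gen" "v \<in> inv_gen" "u \<in> Phi g" "v \<in> Phi h" "x \<in> Phi (u + v)"
proof -
  have xK: "x \<in> K" "f x \<in> Phi x" "gen x" using inv_genD[OF x] by auto
  have gK: "g \<in> K" "h \<in> K" using g h Phi_subset by auto
  obtain u where u: "u \<in> inv_gen" "u \<in> Phi g" "\<And>w. w \<in> Phi g \<Longrightarrow> gen w \<Longrightarrow> w \<in> Phi u"
    using exists_max_inv_gen[OF gK(1) g(2)] by metis
  obtain v where v: "v \<in> inv_gen" "v \<in> Phi h" "\<And>w. w \<in> Phi h \<Longrightarrow> gen w \<Longrightarrow> w \<in> Phi v"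
    using exists_max_inv_gen[OF gK(2) h(2)] by metis
  have uv: "u + v \<in> inv_gen" using inv_gen_add u v by blast
  have uvK: "u \<in> K" "v \<in> K" "u + v \<in> K" "f (u + v) \<in> Phi (u + v)" using inv_genD uv u v by auto
  have sub: "u \<in> Phi (u + v)" "v \<in> Phi (u + v)" using uvK by (auto simp: Phi_def intro: exI[of _ 1])
  have "x \<in> Phi (u + v)"
  proof (rule ccontr)
    assume "\<not> ?thesis"
    then have nx: "x \<notin> span (Phi (u + v))" using xK Phi_eq_span[OF uvK(3)] by blast
    have xd: "x \<in> res_dom" using gen_res_dom xK by blast
    then have gd: "g \<in> res_dom" "h \<in> res_dom" using Phi_res_dom[OF xK(1)] g h by auto
    have mu: "lam + step n > lam" for n using step_pos by simp
    obtain Q where Q: "linear Q" "\<And>w. Q w = 0 \<longleftrightarrow> w \<in> span (Phi (u + v))"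
      "\<And>w. w - Q w \<in> span (Phi (u + v))"
      using exists_mod_projection by metis
    have cl: "closed (P ` K)" if "linear P" for P :: "'a \<Rightarrow> 'a"
      using assms(1) that by (auto simp: closed_quotients_def)
    have bdd: "bounded (range (\<lambda>n. Q (R y n)))"
      if y: "y \<in> K" "f y \<in> Phi y" "y \<in> res_dom" and t: "t \<in> inv_gen" "t \<in> Phi y" "t \<in> Phi (u + v)"
        "\<And>w. w \<in> Phi y \<Longrightarrow> gen w \<Longrightarrow> w \<in> Phi t" for y t
    proof -
      obtain P where P: "linear P" "\<And>w. P w = 0 \<longleftrightarrow> w \<in> span (Phi t)" "\<And>w. w - P w \<in> span (Phi t)"
        using exists_mod_projection by metis
      have "bounded (range (\<lambda>n. P (R y n)))"
      proof (rule resolvent_bounded_mod[OF y(1) t(1,2) _ P cl[OF P(1)]])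
        show "R y n \<in> Phi y" for n by (intro res_in_Phi[OF y(3) mu y(1,2)] self_in_Phi y)
        show "step n *\<^sub>R R y n + N (R y n) = y" for n using R_eq y(3) by blast
      qed (use t(4) in blast)
      then show ?thesis
        by (rule bounded_mod_mono[OF P(1) Q(1) span_mono[OF Phi_mono[OF t(3)]] Q(2) P(3)])
    qed
    have "bounded (range (\<lambda>n. Q (R g n)))" "bounded (range (\<lambda>n. Q (R h n)))"
      using bdd[OF gK(1) g(2) gd(1) u(1,2) sub(1) u(3)] bdd[OF gK(2) h(2) gd(2) v(1,2) sub(2) v(3)] by auto
    then obtain B C where B: "\<And>n. norm (Q (R g n)) \<le> B" "\<And>n. norm (Q (R h n)) \<le> C"
      by (auto simp: bounded_iff)
    obtain \<kappa> where k: "\<kappa> > 0" "\<And>u v. u \<in> K \<Longrightarrow> v - u \<in> K \<Longrightarrow> norm (Q u) \<le> \<kappa> * norm (Q v)"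
      by (rule normal_image_mod[OF uvK(3) Q(1,2) cl[OF Q(1)]]) (rule that)
    obtain c where c: "c \<ge> 0" "c *\<^sub>R (g + h) - x \<in> K" using xgh by (auto simp: Phi_def)
    have "norm (Q (R x n)) \<le> \<kappa> * (c * (B + C))" for n
    proof -
      have d: "c *\<^sub>R (g + h) \<in> res_dom" using gd by (intro res_dom_add res_dom_scale)
      have "R (c *\<^sub>R (g + h) - x) n \<in> K" "R x n \<in> K"
        using c xd d mu xK by (auto intro!: res_in_K res_dom_diff)
      moreover have "R (c *\<^sub>R (g + h) - x) n = c *\<^sub>R (R g n + R h n) - R x n"
        using res_diff[OF d xd mu] res_scale[OF res_dom_add[OF gd] mu] res_add[OF gd mu] by simp
      ultimately have "norm (Q (R x n)) \<le> \<kappa> * norm (Q (c *\<^sub>R (R g n + R h n)))" using k(2) by simp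
      also have "norm (Q (c *\<^sub>R (R g n + R h n))) = c * norm (Q (R g n) + Q (R h n))"
        using c(1) unfolding linear_scale[OF Q(1)] linear_add[OF Q(1)] by simp
      also have "\<dots> \<le> c * (B + C)"
        using c(1) norm_triangle_ineq[of "Q (R g n)" "Q (R h n)"] B(1)[of n] B(2)[of n]
        by (intro mult_left_mono) auto
      finally show ?thesis using k(1) by (simp add: mult_left_mono)
    qed
    then have "bounded (range (\<lambda>n. Q (R x n)))" by (auto simp: bounded_iff)
    then show False
      using R_unbounded_mod[OF xK(3) subspace_span N_span_Phi[OF uvK(3,4)] nx Q] by blast
  qed
  then show thesis using that u v by blast
qed

subsection \<open>Join-irreducible faces\<close>

definition irr :: "'a \<Rightarrow> bool" where
  "irr x \<longleftrightarrow> (\<forall>g h. g \<in> Phi x \<and> f g \<in> Phi g \<and> h \<in> Phi x \<and> f h \<in> Phi h \<and> x \<in> Phi (g + h) \<longrightarrow>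
     x \<in> Phi g \<or> x \<in> Phi h)"

lemma Nk_Suc: "(N ^^ k) (N v) = (N ^^ Suc k) v"
  by (metis comp_apply funpow_Suc_right)

lemma res_zero: "res \<mu> 0 = 0"
  by (simp add: res_def linear_0[OF linear_fk])

lemma single_block_subspace:
  assumes one: "\<And>u v. N u = 0 \<Longrightarrow> N v = 0 \<Longrightarrow> u \<noteq> 0 \<Longrightarrow> \<exists>\<alpha>. v = \<alpha> *\<^sub>R u"
    and W: "subspace W" "N ` W \<subseteq> W"
    and "u \<in> W" "(N ^^ Suc q) u = 0" "(N ^^ q) u \<noteq> 0" "(N ^^ Suc q) v = 0"
  shows "v \<in> W"
  using assms(4-)
proof (induction q arbitrary: u v)
  case 0
  then obtain \<alpha> where "v = \<alpha> *\<^sub>R u" using one[of u v] by auto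
  then show ?case using 0 W by (simp add: subspace_scale)
next
  case (Suc q)
  have "N ((N ^^ Suc q) u) = 0" "N ((N ^^ Suc q) v) = 0" using Suc.prems by simp_all
  then obtain \<alpha> where a: "(N ^^ Suc q) v = \<alpha> *\<^sub>R (N ^^ Suc q) u" using one Suc.prems(3) by blast
  have 1: "N u \<in> W" using Suc.prems(1) W by blast
  have 2: "(N ^^ Suc q) (N u) = 0" "(N ^^ q) (N u) \<noteq> 0" using Suc.prems unfolding Nk_Suc by auto
  have 3: "(N ^^ Suc q) (v - \<alpha> *\<^sub>R u) = 0"
    using a unfolding linear_diff[OF linear_funpow[OF linear_N]]
      linear_scale[OF linear_funpow[OF linear_N]] by simp
  have "v - \<alpha> *\<^sub>R u \<in> W" by (rule Suc.IH[OF 1 2 3])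
  then have "(v - \<alpha> *\<^sub>R u) + \<alpha> *\<^sub>R u \<in> W" using W Suc.prems(1) by (intro subspace_add subspace_scale)
  then show ?case by simp
qed

text \<open>For solutions of the resolvent equation, applying \<open>N\<close> costs exactly one factor of \<open>step\<close>.\<close>

lemma bounded_step_power_iff:
  assumes "\<And>n. step n *\<^sub>R w n + N (w n) = y"
  shows "bounded (range (\<lambda>n. step n ^ q *\<^sub>R w n)) \<longleftrightarrow> bounded (range (\<lambda>n. (N ^^ q) (w n)))"
proof -
  have st: "bounded (range (\<lambda>n. step n ^ i *\<^sub>R v))" for i and v :: 'a
  proof -
    have "step n \<le> 1" for n by (simp add: step_def field_simps)
    then have "step n ^ i \<le> 1" for n using step_pos[of n] by (intro power_le_one) auto
    then have "norm (step n ^ i *\<^sub>R v) \<le> norm v" for n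
      using step_pos[of n] by (simp add: power_abs mult_left_le_one_le)
    then show ?thesis by (auto simp: bounded_iff)
  qed
  have "bounded (range (\<lambda>n. step n ^ i *\<^sub>R (N ^^ j) (w n))) \<longleftrightarrow>
      bounded (range (\<lambda>n. (N ^^ (i + j)) (w n)))" for i j
  proof (induction i arbitrary: j)
    case (Suc i)
    have "step n ^ Suc i *\<^sub>R (N ^^ j) (w n)
        = step n ^ i *\<^sub>R (N ^^ j) y - step n ^ i *\<^sub>R (N ^^ Suc j) (w n)" for n
    proof -
      have "(N ^^ j) y = step n *\<^sub>R (N ^^ j) (w n) + (N ^^ Suc j) (w n)"
        using assms[of n, symmetric] linear_add[OF linear_funpow[OF linear_N]]
          linear_scale[OF linear_funpow[OF linear_N]] Nk_Suc by simp
      then show ?thesis by (simp add: scaleR_add_right mult.commute)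
    qed
    then have "bounded (range (\<lambda>n. step n ^ Suc i *\<^sub>R (N ^^ j) (w n))) \<longleftrightarrow>
        bounded (range (\<lambda>n. step n ^ i *\<^sub>R (N ^^ Suc j) (w n)))"
      using st by (rule bounded_range_diff_iff)
    then show ?case using Suc.IH[of "Suc j"] by simp
  qed simp
  from this[of q 0] show ?thesis by simp
qed

lemma irr_if_single_block:
  assumes one: "\<And>u v. N u = 0 \<Longrightarrow> N v = 0 \<Longrightarrow> u \<noteq> 0 \<Longrightarrow> \<exists>\<alpha>. v = \<alpha> *\<^sub>R u"
    and x: "x \<in> inv_gen" "x \<noteq> 0"
  shows "irr x"
  unfolding irr_def
proof (intro allI impI, elim conjE)
  fix g h assume g: "g \<in> Phi x" "f g \<in> Phi g" and h: "h \<in> Phi x" "f h \<in> Phi h" and xgh: "x \<in> Phi (g + h)"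
  have xK: "x \<in> K" "f x \<in> Phi x" "gen x" using inv_genD x by auto
  have gK: "g \<in> K" "h \<in> K" using g h Phi_subset by auto
  have xd: "x \<in> res_dom" using gen_res_dom xK by blast
  then have gd: "g \<in> res_dom" "h \<in> res_dom" using Phi_res_dom[OF xK(1)] g h by auto
  have mu: "lam + step n > lam" for n using step_pos by simp
  obtain m where "(N ^^ m) x = 0" using xK by (auto simp: gen_def)
  define p where "p = (LEAST p. (N ^^ p) x = 0)"
  have p: "(N ^^ p) x = 0" unfolding p_def by (rule LeastI) fact
  then have "p \<noteq> 0" using x(2) by (metis funpow_0)
  then obtain q where q: "p = Suc q" using not0_implies_Suc by blast
  have nq: "(N ^^ q) x \<noteq> 0" using not_less_Least[of q] q unfolding p_def by force
  have pq: "(N ^^ Suc q) x = 0" using p q by simp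
  show "x \<in> Phi g \<or> x \<in> Phi h"
  proof (rule ccontr)
    assume no: "\<not> ?thesis"
    have bdd: "bounded (range (\<lambda>n. step n ^ q *\<^sub>R R y n))"
      if y: "y \<in> K" "f y \<in> Phi y" "y \<in> res_dom" "x \<notin> Phi y" for y
    proof -
      let ?W = "span (Phi y)"
      have W: "N ` ?W \<subseteq> ?W" by (rule N_span_Phi[OF y(1,2)])
      have xW: "x \<notin> ?W" using y xK Phi_eq_span by blast
      have RW: "R y n \<in> ?W" for n
        using res_in_Phi[OF y(3) mu y(1,2) self_in_Phi[OF y(1)]] by (rule span_base)
      have eq: "step n *\<^sub>R R y n + N (R y n) = y" for n using R_eq y(3) by blast
      have "bounded (range (\<lambda>n. (N ^^ q) (R y n)))"
      proof (rule ccontr)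
        assume unb: "\<not> ?thesis"
        have S: "subspace ((N ^^ q) ` ?W)"
          by (rule linear_subspace_image[OF linear_funpow[OF linear_N] subspace_span])
        have eq': "step n *\<^sub>R (N ^^ q) (R y n) + N ((N ^^ q) (R y n)) = (N ^^ q) y" for n
          using Nk_res[OF y(3) mu, of q n] R_eq[of "(N ^^ q) y" n] by simp
        obtain z where z: "z \<in> (N ^^ q) ` ?W" "z \<noteq> 0" "N z = 0"
        proof (rule unbounded_resolvent_imp_null_vector[OF linear_N closed_subspace[OF S] _ _ eq' step_tendsto unb])
          show "conic ((N ^^ q) ` ?W)" using S by (rule subspace_imp_conic)
        qed (use RW in blast)+
        then obtain u where "u \<in> ?W" "(N ^^ q) u \<noteq> 0" "(N ^^ Suc q) u = 0" by auto
        then have "x \<in> ?W" using single_block_subspace[OF one subspace_span W] pq by blast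
        then show False using xW by blast
      qed
      then show ?thesis using bounded_step_power_iff[OF eq] by blast
    qed
    obtain B C where B: "\<And>n. norm (step n ^ q *\<^sub>R R g n) \<le> B" "\<And>n. norm (step n ^ q *\<^sub>R R h n) \<le> C"
      using bdd[OF gK(1) g(2) gd(1)] bdd[OF gK(2) h(2) gd(2)] no by (auto simp: bounded_iff)
    obtain \<kappa> where k: "\<kappa> > 0" "\<And>u v. u \<in> K \<Longrightarrow> v - u \<in> K \<Longrightarrow> norm u \<le> \<kappa> * norm v"
      by (rule normal_K) (rule that)
    obtain c where c: "c \<ge> 0" "c *\<^sub>R (g + h) - x \<in> K" using xgh by (auto simp: Phi_def)
    have "norm (step n ^ q *\<^sub>R R x n) \<le> \<kappa> * (c * (B + C))" for n
    proof -
      have d: "c *\<^sub>R (g + h) \<in> res_dom" using gd by (intro res_dom_add res_dom_scale)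
      have "R (c *\<^sub>R (g + h) - x) n \<in> K" "R x n \<in> K"
        using c xd d mu xK by (auto intro!: res_in_K res_dom_diff)
      then have "step n ^ q *\<^sub>R R (c *\<^sub>R (g + h) - x) n \<in> K" "step n ^ q *\<^sub>R R x n \<in> K"
        using step_pos[of n] by (auto intro!: scale_K)
      moreover have "step n ^ q *\<^sub>R R (c *\<^sub>R (g + h) - x) n
          = c *\<^sub>R (step n ^ q *\<^sub>R R g n + step n ^ q *\<^sub>R R h n) - step n ^ q *\<^sub>R R x n"
        unfolding res_diff[OF d xd mu] res_scale[OF res_dom_add[OF gd] mu] res_add[OF gd mu]
        by (simp add: scaleR_diff_right scaleR_add_right mult.commute)
      ultimately have "norm (step n ^ q *\<^sub>R R x n)
          \<le> \<kappa> * norm (c *\<^sub>R (step n ^ q *\<^sub>R R g n + step n ^ q *\<^sub>R R h n))" by (metis k(2))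
      also have "norm (c *\<^sub>R (step n ^ q *\<^sub>R R g n + step n ^ q *\<^sub>R R h n))
          = c * norm (step n ^ q *\<^sub>R R g n + step n ^ q *\<^sub>R R h n)" using c(1) by simp
      also have "\<dots> \<le> c * (B + C)"
        using c(1) norm_triangle_ineq[of "step n ^ q *\<^sub>R R g n" "step n ^ q *\<^sub>R R h n"] B(1)[of n] B(2)[of n]
        by (intro mult_left_mono) linarith+
      finally show ?thesis using k(1) by (simp add: mult_left_mono)
    qed
    then have "bounded (range (\<lambda>n. step n ^ q *\<^sub>R R x n))" by (auto simp: bounded_iff)
    then have "bounded (range (\<lambda>n. (N ^^ q) (R x n)))"
      using bounded_step_power_iff[of "R x" x q] R_eq[OF xd] by blast
    then obtain b where b: "\<And>n. norm ((N ^^ q) (R x n)) \<le> b" by (auto simp: bounded_iff)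
    have "step n *\<^sub>R (N ^^ q) (R x n) = (N ^^ q) x" for n
    proof -
      have "N ((N ^^ q) (R x n)) = R ((N ^^ Suc q) x) n" using Nk_res[OF xd mu, of "Suc q" n] by simp
      also have "\<dots> = 0" unfolding pq by (rule res_zero)
      finally show ?thesis using R_eq[of "(N ^^ q) x" n] Nk_res[OF xd mu, of q n] by simp
    qed
    then have "norm ((N ^^ q) x) \<le> step n * b" for n
      using b[of n] step_pos[of n] by (metis abs_of_pos mult_left_mono norm_scaleR less_imp_le)
    moreover have "(\<lambda>n. step n * b) \<longlonglongrightarrow> 0 * b" by (intro tendsto_mult step_tendsto tendsto_const)
    ultimately have "norm ((N ^^ q) x) \<le> 0"
      by (intro tendsto_lowerbound[of "\<lambda>n. step n * b" 0 sequentially]) auto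
    then show False using nq by simp
  qed
qed

lemma split_eigen:
  assumes x: "x \<in> K" "N x = 0"
    and g: "g \<in> Phi x" "f g \<in> Phi g" and h: "h \<in> Phi x" "f h \<in> Phi h" and xgh: "x \<in> Phi (g + h)"
  obtains u v where "u \<in> Phi g" "N u = 0" "v \<in> Phi h" "N v = 0" "x \<in> Phi (u + v)"
proof -
  have xK: "f x \<in> Phi x" "gen x" using eigen_inv_gen[OF x] inv_genD by auto
  have gK: "g \<in> K" "h \<in> K" using g h Phi_subset by auto
  have xd: "x \<in> res_dom" using gen_res_dom xK by blast
  then have gd: "g \<in> res_dom" "h \<in> res_dom" using Phi_res_dom[OF x(1)] g h by auto
  have mu: "lam + step n > lam" for n using step_pos by simp
  have Rx: "step n *\<^sub>R R x n = x" for n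
  proof -
    have "N (R x n) = R (N x) n" by (rule N_res[OF xd mu])
    also have "\<dots> = 0" unfolding x(2) by (rule res_zero)
    finally show ?thesis using R_eq[OF xd, of n] by simp
  qed
  have dom: "c *\<^sub>R (step n *\<^sub>R R y n) - x \<in> K" if "c *\<^sub>R y - x \<in> K" "y \<in> res_dom" for c y n
  proof -
    have "R (c *\<^sub>R y - x) n \<in> K" using that xd mu by (auto intro!: res_in_K res_dom_diff res_dom_scale)
    then have "step n *\<^sub>R R (c *\<^sub>R y - x) n \<in> K" using step_pos[of n] by (auto intro!: scale_K)
    moreover have "step n *\<^sub>R R (c *\<^sub>R y - x) n = c *\<^sub>R (step n *\<^sub>R R y n) - step n *\<^sub>R R x n"
      unfolding res_diff[OF res_dom_scale[OF that(2)] xd mu] res_scale[OF that(2) mu]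
      by (simp add: scaleR_diff_right mult.commute)
    ultimately show ?thesis using Rx[of n] by simp
  qed
  obtain \<kappa> where k: "\<kappa> > 0" "\<And>u v. u \<in> K \<Longrightarrow> v - u \<in> K \<Longrightarrow> norm u \<le> \<kappa> * norm v"
    by (rule normal_K) (rule that)
  have bdd: "\<exists>B. \<forall>n. step n *\<^sub>R R y n \<in> cball 0 B" if y: "y \<in> Phi x" "y \<in> res_dom" for y
  proof -
    obtain c where c: "c \<ge> 0" "c *\<^sub>R x - y \<in> K" "y \<in> K" using y by (auto simp: Phi_def)
    have "norm (step n *\<^sub>R R y n) \<le> \<kappa> * norm (c *\<^sub>R x)" for n
    proof (rule k(2))
      show "step n *\<^sub>R R y n \<in> K"
        using res_in_K[OF y(2) mu c(3)] step_pos[of n] by (intro scale_K) auto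
      have "R (c *\<^sub>R x - y) n \<in> K" using c y xd mu by (auto intro!: res_in_K res_dom_diff res_dom_scale)
      then have "step n *\<^sub>R R (c *\<^sub>R x - y) n \<in> K" using step_pos[of n] by (auto intro!: scale_K)
      moreover have "step n *\<^sub>R R (c *\<^sub>R x - y) n = c *\<^sub>R (step n *\<^sub>R R x n) - step n *\<^sub>R R y n"
        unfolding res_diff[OF res_dom_scale[OF xd] y(2) mu] res_scale[OF xd mu]
        by (simp add: scaleR_diff_right mult.commute)
      ultimately show "c *\<^sub>R x - step n *\<^sub>R R y n \<in> K" using Rx[of n] by simp
    qed
    then show ?thesis by (auto simp: mem_cball_0)
  qed
  have lim0: "N u = 0" if r: "strict_mono r" and lim: "(\<lambda>n. step (r n) *\<^sub>R R y (r n)) \<longlonglongrightarrow> u" and y: "y \<in> res_dom" for r u y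
  proof -
    have "(\<lambda>n. step (r n)) \<longlonglongrightarrow> 0" using LIMSEQ_subseq_LIMSEQ[OF step_tendsto r] by (simp add: o_def)
    then have "(\<lambda>n. step (r n) *\<^sub>R (y - step (r n) *\<^sub>R R y (r n))) \<longlonglongrightarrow> 0 *\<^sub>R (y - u)"
      using lim by (intro tendsto_scaleR tendsto_diff tendsto_const)
    moreover have "N (step (r n) *\<^sub>R R y (r n)) = step (r n) *\<^sub>R (y - step (r n) *\<^sub>R R y (r n))" for n
      using R_eq[OF y, of "r n"] linear_scale[OF linear_N] by (metis add_diff_cancel_left')
    ultimately have "(\<lambda>n. N (step (r n) *\<^sub>R R y (r n))) \<longlonglongrightarrow> 0" by simp
    moreover have "(\<lambda>n. N (step (r n) *\<^sub>R R y (r n))) \<longlonglongrightarrow> N u"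
      using linear_N lim by (intro bounded_linear.tendsto[of N]) (simp_all add: linear_conv_bounded_linear)
    ultimately show ?thesis using LIMSEQ_unique by blast
  qed
  obtain B where B: "\<And>n. step n *\<^sub>R R g n \<in> cball 0 B" using bdd[OF g(1) gd(1)] by blast
  obtain C where C: "\<And>n. step n *\<^sub>R R h n \<in> cball 0 C" using bdd[OF h(1) gd(2)] by blast
  obtain u r where r: "strict_mono r" "((\<lambda>n. step n *\<^sub>R R g n) \<circ> r) \<longlonglongrightarrow> u"
    using compact_cball[of 0 B, unfolded compact_def] B by (metis (no_types, lifting))
  obtain v s where s: "strict_mono s" "((\<lambda>n. step (r n) *\<^sub>R R h (r n)) \<circ> s) \<longlonglongrightarrow> v"
    using compact_cball[of 0 C, unfolded compact_def] C by (metis (no_types, lifting))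
  have rs: "strict_mono (r \<circ> s)" using r s by (simp add: strict_mono_o)
  have lu: "(\<lambda>n. step ((r \<circ> s) n) *\<^sub>R R g ((r \<circ> s) n)) \<longlonglongrightarrow> u"
    using LIMSEQ_subseq_LIMSEQ[OF r(2) s(1)] by (simp add: o_def)
  have lv: "(\<lambda>n. step ((r \<circ> s) n) *\<^sub>R R h ((r \<circ> s) n)) \<longlonglongrightarrow> v"
    using s(2) by (simp add: o_def)
  have mem: "z \<in> Phi y" if "(\<lambda>n. step ((r \<circ> s) n) *\<^sub>R R y ((r \<circ> s) n)) \<longlonglongrightarrow> z" "y \<in> res_dom" "y \<in> K" "f y \<in> Phi y" for z y
  proof (rule closed_sequentially[OF closed_Phi[OF that(3)] _ that(1)])
    show "step ((r \<circ> s) n) *\<^sub>R R y ((r \<circ> s) n) \<in> Phi y" for n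
      using res_in_Phi[OF that(2) mu that(3,4) self_in_Phi[OF that(3)]] step_pos[of "(r \<circ> s) n"]
      by (intro scale_Phi that) auto
  qed
  obtain c where c: "c \<ge> 0" "c *\<^sub>R (g + h) - x \<in> K" using xgh by (auto simp: Phi_def)
  have "c *\<^sub>R (u + v) - x \<in> K"
  proof (rule closed_sequentially[OF closed_K])
    show "(\<lambda>n. c *\<^sub>R (step ((r \<circ> s) n) *\<^sub>R R g ((r \<circ> s) n) + step ((r \<circ> s) n) *\<^sub>R R h ((r \<circ> s) n)) - x)
        \<longlonglongrightarrow> c *\<^sub>R (u + v) - x" by (intro tendsto_intros lu lv)
    show "c *\<^sub>R (step ((r \<circ> s) n) *\<^sub>R R g ((r \<circ> s) n) + step ((r \<circ> s) n) *\<^sub>R R h ((r \<circ> s) n)) - x \<in> K" for n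
      using dom[OF c(2) res_dom_add[OF gd], of "(r \<circ> s) n"] res_add[OF gd mu, of "(r \<circ> s) n"]
      by (simp add: scaleR_add_right)
  qed
  then have "x \<in> Phi (u + v)" using c x by (auto simp: Phi_def)
  then show thesis
    using that lim0[OF rs lu gd(1)] lim0[OF rs lv gd(2)] mem[OF lu gd(1) gK(1) g(2)] mem[OF lv gd(2) gK(2) h(2)]
    by blast
qed

lemma irr_if_irr_comparable:
  assumes X: "X \<subseteq> inv_gen"
    and split: "\<And>x g h. x \<in> X \<Longrightarrow> g \<in> Phi x \<Longrightarrow> f g \<in> Phi g \<Longrightarrow> h \<in> Phi x \<Longrightarrow> f h \<in> Phi h \<Longrightarrow>
        x \<in> Phi (g + h) \<Longrightarrow> \<exists>u\<in>X. \<exists>v\<in>X. u \<in> Phi g \<and> v \<in> Phi h \<and> x \<in> Phi (u + v)"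
    and comp: "\<And>u v. u \<in> X \<Longrightarrow> v \<in> X \<Longrightarrow> u \<noteq> 0 \<Longrightarrow> v \<noteq> 0 \<Longrightarrow> irr u \<Longrightarrow> irr v \<Longrightarrow> u \<in> Phi v \<or> v \<in> Phi u"
    and "x \<in> X" "x \<noteq> 0"
  shows "irr x"
  using assms(4,5)
proof (induction "dim (Phi x)" arbitrary: x rule: less_induct)
  case less
  have xK: "x \<in> K" using X less.prems by (auto simp: inv_gen_def)
  show ?case unfolding irr_def
  proof (intro allI impI, elim conjE, rule ccontr)
    fix g h assume g: "g \<in> Phi x" "f g \<in> Phi g" and h: "h \<in> Phi x" "f h \<in> Phi h" and xgh: "x \<in> Phi (g + h)"
      and no: "\<not> (x \<in> Phi g \<or> x \<in> Phi h)"
    obtain u v where uv: "u \<in> X" "v \<in> X" "u \<in> Phi g" "v \<in> Phi h" "x \<in> Phi (u + v)"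
      using split[OF less.prems(1) g h xgh] by blast
    have K: "u \<in> K" "v \<in> K" using uv X by (auto simp: inv_gen_def)
    have nx: "x \<notin> Phi u" "x \<notin> Phi v" using no uv Phi_trans by blast+
    have irr: "irr w" if "w \<in> X" "w \<in> Phi x" "x \<notin> Phi w" "w \<noteq> 0" for w
    proof (rule less.hyps)
      have "Phi w \<subset> Phi x" using Phi_mono[OF that(2)] that(3) self_in_Phi[OF xK] by blast
      then show "dim (Phi w) < dim (Phi x)" using that X xK by (intro Phi_psubset_dim) (auto simp: inv_gen_def)
    qed (use that in auto)
    have "u \<in> Phi v \<or> v \<in> Phi u"
    proof (cases "u = 0 \<or> v = 0")
      case True
      then show ?thesis using zero_Phi K by auto
    next
      case False
      then show ?thesis using comp[OF uv(1,2)] irr uv nx g h Phi_trans by blast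
    qed
    then have "u + v \<in> Phi v \<or> u + v \<in> Phi u" using add_Phi self_in_Phi K by blast
    then show False using uv(5) nx Phi_trans by blast
  qed
qed

subsection \<open>Chains of invariant faces\<close>

lemma inv_gen_mod:
  assumes "q \<in> K" "d \<in> inv_gen" "d \<in> Phi q" "gen q" "N q \<in> span (Phi d)"
  shows "q \<in> inv_gen"
proof -
  have d: "d \<in> K" using assms by (auto simp: inv_gen_def)
  have "- N q \<in> span (Phi d)" using assms(5) by (rule span_neg)
  then obtain c where c: "c \<ge> 0" "\<And>t. t \<ge> c \<Longrightarrow> t *\<^sub>R d - (- N q) \<in> K"
    using span_Phi_order_unit[OF d] by blast
  obtain b where b: "b \<ge> 0" "b *\<^sub>R q - d \<in> K" using assms(3) by (auto simp: Phi_def)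
  have "c *\<^sub>R (b *\<^sub>R q - d) + (c *\<^sub>R d - (- N q)) \<in> K"
    using b c by (intro add_K scale_K) auto
  then have "(lam + c * b) *\<^sub>R q - f q \<in> K" by (simp add: N_def algebra_simps)
  moreover have "lam + c * b \<ge> 0" using lam_nonneg b c by simp
  ultimately have "f q \<in> Phi q" using f_in_K[OF assms(1)] unfolding Phi_def by blast
  then show ?thesis using assms by (simp add: inv_gen_def)
qed

text \<open>Moving from \<open>z\<close> against the direction \<open>p\<close> until the boundary of the quotient cone is reached
  produces a generalized eigenvector whose face no longer contains \<open>p\<close>.\<close>

lemma exists_boundary_inv_gen:
  assumes cq: "closed_quotients" and x: "x \<in> inv_gen" and d: "d \<in> inv_gen" "d \<in> Phi x"
    and p: "p \<in> Phi x" "p \<notin> Phi d" "gen p" "N p \<in> span (Phi d)"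
    and z: "z \<in> span (Phi x)" "gen z" "N z \<in> span (Phi d)"
    and k: "k \<in> K" "z + t *\<^sub>R p - k \<in> span (Phi d)"
  obtains q t s where "q \<in> inv_gen" "q \<in> Phi x" "q = z + t *\<^sub>R p + s" "s \<in> span (Phi d)" "p \<notin> Phi q"
proof -
  have K: "x \<in> K" "d \<in> K" "p \<in> K" using x d p Phi_subset by (auto simp: inv_gen_def)
  obtain Q where Q: "linear Q" "\<And>v. Q v = 0 \<longleftrightarrow> v \<in> span (Phi d)" "\<And>v. v - Q v \<in> span (Phi d)"
    by (rule exists_mod_projection) (rule that)
  have cl: "closed (Q ` K)" using cq Q(1) by (simp add: closed_quotients_def)
  have p0: "Q p \<noteq> 0" using p(2) K Q(2) Phi_eq_span[OF K(2)] by blast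
  have QzEq: "Q (z + t *\<^sub>R p) = Q z + t *\<^sub>R Q p" for t
    using Q(1) by (simp add: linear_add linear_scale)
  define T where "T = {t. Q z + t *\<^sub>R Q p \<in> Q ` K}"
  have "T = (\<lambda>t. Q z + t *\<^sub>R Q p) -` (Q ` K)" by (auto simp: T_def)
  then have "closed T" using cl by (auto intro!: continuous_closed_vimage continuous_intros)
  moreover have "T \<noteq> {}"
  proof -
    have "Q (z + t *\<^sub>R p) = Q k" using k(2) Q(2) linear_diff[OF Q(1)] by (metis eq_iff_diff_eq_0)
    then have "t \<in> T" using k(1) QzEq by (auto simp: T_def)
    then show ?thesis by blast
  qed
  moreover have "bdd_below T"
  proof -
    obtain \<kappa> where kp: "\<kappa> > 0" "\<And>u v. u \<in> K \<Longrightarrow> v - u \<in> K \<Longrightarrow> norm (Q u) \<le> \<kappa> * norm (Q v)"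
      by (rule normal_image_mod[OF K(2) Q(1,2) cl]) (rule that)
    have "- (\<kappa> * norm (Q z) / norm (Q p)) \<le> t" if "t \<in> T" for t
    proof (cases "t \<ge> 0")
      case True
      then show ?thesis using kp(1) by (smt (verit) divide_nonneg_nonneg mult_nonneg_nonneg norm_ge_zero)
    next
      case False
      obtain k where k: "k \<in> K" "Q z + t *\<^sub>R Q p = Q k" using \<open>t \<in> T\<close> by (auto simp: T_def)
      have "norm (Q ((- t) *\<^sub>R p)) \<le> \<kappa> * norm (Q ((- t) *\<^sub>R p + k))"
        using False K k by (intro kp(2)) (auto intro: scale_K simp del: scaleR_minus_left)
      also have "Q ((- t) *\<^sub>R p + k) = Q z"
        using k(2)[symmetric] Q(1) by (simp add: linear_add linear_scale linear_diff)
      also have "norm (Q ((- t) *\<^sub>R p)) = (- t) * norm (Q p)"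
        using False Q(1) by (simp add: linear_scale del: scaleR_minus_left)
      finally show ?thesis using p0 by (simp add: field_simps)
    qed
    then show ?thesis by (intro bdd_belowI)
  qed
  ultimately have t0: "Inf T \<in> T" by (intro closed_contains_Inf)
  define t0 where "t0 = Inf T"
  have least: "t \<notin> T" if "t < t0" for t
    using that cInf_lower[OF _ \<open>bdd_below T\<close>, of t] unfolding t0_def by force
  obtain k0 where k0: "k0 \<in> K" "Q (z + t0 *\<^sub>R p) = Q k0"
    using t0 QzEq unfolding T_def t0_def by auto
  have s0: "k0 - (z + t0 *\<^sub>R p) \<in> span (Phi d)" using k0(2) Q(2) linear_diff[OF Q(1)] by (metis eq_iff_diff_eq_0)
  obtain c where c: "c \<ge> 0" "\<And>t. t \<ge> c \<Longrightarrow> t *\<^sub>R d - (k0 - (z + t0 *\<^sub>R p)) \<in> K"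
    using span_Phi_order_unit[OF K(2) s0] by blast
  define q where "q = z + t0 *\<^sub>R p + (c + 1) *\<^sub>R d"
  have dspan: "d \<in> span (Phi d)" using self_in_Phi[OF K(2)] by (rule span_base)
  have qd: "q - d \<in> K"
    using add_K[OF k0(1) c(2)[of c]] by (simp add: q_def algebra_simps)
  then have qK: "q \<in> K" using add_K[OF qd K(2)] by simp
  have dq: "d \<in> Phi q" using qd K by (auto simp: Phi_def intro: exI[of _ 1])
  have "d \<in> span (Phi x)" "p \<in> span (Phi x)" using d p by (auto intro: span_base)
  then have "q \<in> span (Phi x)" unfolding q_def using z(1) by (intro span_add span_scale)
  then have qx: "q \<in> Phi x" using qK Phi_eq_span[OF K(1)] by blast
  have "gen q" unfolding q_def using z p d by (intro gen_add gen_scale) (auto simp: inv_gen_def)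
  moreover have "N q \<in> span (Phi d)"
  proof -
    have "N d \<in> span (Phi d)" using N_span_Phi dspan d(1) by (auto simp: inv_gen_def)
    then show ?thesis unfolding q_def linear_add[OF linear_N] linear_scale[OF linear_N]
      using z p by (intro span_add span_scale) auto
  qed
  ultimately have qi: "q \<in> inv_gen" using inv_gen_mod[OF qK d(1) dq] by blast
  have "p \<notin> Phi q"
  proof
    assume "p \<in> Phi q"
    then obtain b where b: "b \<ge> 0" "b *\<^sub>R q - p \<in> K" by (auto simp: Phi_def)
    define b' where "b' = b + 1"
    have b': "b' > 0" "b' *\<^sub>R q - p \<in> K" using b add_K[OF b(2) qK] by (auto simp: b'_def algebra_simps)
    then have "(1 / b') *\<^sub>R (b' *\<^sub>R q - p) \<in> K" by (intro scale_K) auto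
    then have qp: "q - (1 / b') *\<^sub>R p \<in> K" using b'(1) by (simp add: scaleR_diff_right)
    have "Q (q - (1 / b') *\<^sub>R p) = Q z + (t0 - 1 / b') *\<^sub>R Q p"
      using Q(1) dspan Q(2)[of d] unfolding q_def
      by (simp add: linear_add linear_scale linear_diff scaleR_diff_left)
    then have "t0 - 1 / b' \<in> T" using qp unfolding T_def by (metis (mono_tags) imageI mem_Collect_eq)
    then show False using least[of "t0 - 1 / b'"] b'(1) by simp
  qed
  moreover have "(c + 1) *\<^sub>R d \<in> span (Phi d)" using dspan by (rule span_scale)
  ultimately show thesis using that[OF qi qx q_def] by blast
qed

definition pred_face :: "'a \<Rightarrow> 'a \<Rightarrow> bool" where
  "pred_face e x \<longleftrightarrow> x \<in> inv_gen \<and> e \<in> inv_gen \<and> e \<in> Phi x \<and> x \<notin> Phi e \<and>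
     (\<forall>y\<in>inv_gen. y \<in> Phi x \<longrightarrow> x \<notin> Phi y \<longrightarrow> y \<in> Phi e)"

lemma exists_pred_face:
  assumes chain: "\<And>x y. x \<in> inv_gen \<Longrightarrow> y \<in> inv_gen \<Longrightarrow> x \<in> Phi y \<or> y \<in> Phi x"
    and x: "x \<in> inv_gen" "x \<noteq> 0"
  obtains e where "pred_face e x"
proof -
  define P where "P y \<longleftrightarrow> y \<in> inv_gen \<and> y \<in> Phi x \<and> x \<notin> Phi y" for y
  have "P 0" using inv_gen_zero x Phi_zero zero_Phi by (auto simp: P_def inv_gen_def)
  moreover have "\<forall>y. P y \<longrightarrow> dim (Phi y) \<le> DIM('a)" by (simp add: dim_subset_UNIV)
  ultimately obtain e where e: "P e" "\<And>y. P y \<Longrightarrow> dim (Phi y) \<le> dim (Phi e)"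
    using ex_has_greatest_nat[of P 0 "\<lambda>y. dim (Phi y)" "DIM('a) + 1"] by (metis le_imp_less_Suc Suc_eq_plus1)
  have "y \<in> Phi e" if y: "P y" for y
  proof (rule ccontr)
    assume n: "y \<notin> Phi e"
    then have "e \<in> Phi y" using chain e(1) y by (auto simp: P_def)
    then have "Phi e \<subset> Phi y" using n Phi_mono self_in_Phi y by (auto simp: P_def inv_gen_def)
    then have "dim (Phi e) < dim (Phi y)" using e(1) y by (intro Phi_psubset_dim) (auto simp: P_def inv_gen_def)
    then show False using e(2)[OF y] by simp
  qed
  then show thesis using that[of e] e(1) x by (auto simp: P_def pred_face_def)
qed

lemma pred_face_reach:
  assumes pr: "pred_face e y" and p: "p \<in> Phi y" "p \<notin> Phi e" "gen p" "N p \<in> span (Phi e)"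
    and v: "v \<in> span (Phi y)"
  obtains t k where "k \<in> K" "v + t *\<^sub>R p - k \<in> span (Phi e)"
proof -
  have e: "e \<in> inv_gen" "e \<in> Phi y" and y: "y \<in> inv_gen" using pr by (auto simp: pred_face_def)
  have K: "y \<in> K" "e \<in> K" "p \<in> K" using y e p Phi_subset by (auto simp: inv_gen_def)
  define q where "q = p + e"
  have qK: "q \<in> K" using K add_K by (simp add: q_def)
  have eq: "e \<in> Phi q" "p \<in> Phi q" using K by (auto simp: q_def Phi_def intro: exI[of _ 1])
  have espan: "e \<in> span (Phi e)" using self_in_Phi[OF K(2)] by (rule span_base)
  have "N e \<in> span (Phi e)" using N_span_Phi e(1) espan by (auto simp: inv_gen_def)
  then have "N q \<in> span (Phi e)" unfolding q_def linear_add[OF linear_N] using p by (intro span_add)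
  moreover have "gen q" unfolding q_def using p e by (intro gen_add) (auto simp: inv_gen_def)
  ultimately have "q \<in> inv_gen" using inv_gen_mod[OF qK e(1) eq(1)] by blast
  moreover have "q \<in> Phi y" unfolding q_def using p e K by (intro add_Phi)
  moreover have "q \<notin> Phi e" using eq p Phi_trans by blast
  ultimately have "y \<in> Phi q" using pr by (auto simp: pred_face_def)
  then have "- v \<in> span (Phi q)" using span_mono[OF Phi_mono] v by (blast intro: span_neg)
  then obtain c where "\<And>t. t \<ge> c \<Longrightarrow> t *\<^sub>R q - (- v) \<in> K" using span_Phi_order_unit[OF qK] by blast
  then have "c *\<^sub>R q + v \<in> K" by (metis diff_minus_eq_add order_refl)
  moreover have "v + c *\<^sub>R p - (c *\<^sub>R q + v) \<in> span (Phi e)"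
    using span_neg[OF span_scale[OF espan, of c]] by (simp add: q_def algebra_simps)
  ultimately show thesis using that by blast
qed

lemma pred_face_eigen_mod_unique:
  assumes cq: "closed_quotients" and pr: "pred_face e y"
    and p: "p \<in> Phi y" "p \<notin> Phi e" "gen p" "N p \<in> span (Phi e)"
    and z: "z \<in> span (Phi y)" "gen z" "N z \<in> span (Phi e)"
  obtains t where "z + t *\<^sub>R p \<in> span (Phi e)"
proof -
  have e: "e \<in> inv_gen" "e \<in> Phi y" and y: "y \<in> inv_gen" using pr by (auto simp: pred_face_def)
  obtain t k where k: "k \<in> K" "z + t *\<^sub>R p - k \<in> span (Phi e)"
    using pred_face_reach[OF pr p z(1)] by blast
  obtain q t0 s where q: "q \<in> inv_gen" "q \<in> Phi y" "q = z + t0 *\<^sub>R p + s" "s \<in> span (Phi e)" "p \<notin> Phi q"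
    using exists_boundary_inv_gen[OF cq y e p z k] by blast
  have "y \<notin> Phi q" using q(5) p(1) Phi_trans by blast
  then have "q \<in> Phi e" using pr q by (auto simp: pred_face_def)
  then have "q - s \<in> span (Phi e)" using q(4) by (intro span_diff[OF span_base])
  then show thesis using that[of t0] q(3) by simp
qed

lemma eigenvector_pred_face_zero:
  assumes cq: "closed_quotients"
    and chain: "\<And>x y. x \<in> inv_gen \<Longrightarrow> y \<in> inv_gen \<Longrightarrow> x \<in> Phi y \<or> y \<in> Phi x"
    and pr: "pred_face e y" and z: "N z = 0" "z \<in> span (Phi y)" "z \<notin> span (Phi e)"
  shows "e = 0"
proof (rule ccontr)
  assume "e \<noteq> 0"
  have e: "e \<in> inv_gen" "e \<in> Phi y" "y \<notin> Phi e" and y: "y \<in> inv_gen" using pr by (auto simp: pred_face_def)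
  have K: "y \<in> K" "e \<in> K" using y e by (auto simp: inv_gen_def)
  obtain d where pd: "pred_face d e" using exists_pred_face[OF chain e(1) \<open>e \<noteq> 0\<close>] by blast
  have d: "d \<in> inv_gen" "d \<in> Phi e" "e \<notin> Phi d" using pd by (auto simp: pred_face_def)
  obtain p where p: "p \<in> Phi y" "p \<notin> Phi e" "gen p" "N p \<in> span (Phi e)"
    using exists_eigen_mod[OF cq y e] by blast
  obtain p2 where p2: "p2 \<in> Phi e" "p2 \<notin> Phi d" "gen p2" "N p2 \<in> span (Phi d)"
    using exists_eigen_mod[OF cq e(1) d] by blast
  have gz: "gen z" using z(1) unfolding gen_def by (auto intro!: exI[of _ 1])
  obtain t where t: "z + t *\<^sub>R p \<in> span (Phi e)"
    using pred_face_eigen_mod_unique[OF cq pr p z(2) gz] z(1) by (metis span_zero)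
  have "t \<noteq> 0" using t z(3) by auto
  obtain z' \<alpha> where z': "N z' = 0" "z' \<in> span (Phi y)" "z' \<notin> span (Phi e)" "\<alpha> > 0"
    "z' - \<alpha> *\<^sub>R p \<in> span (Phi e)"
  proof (cases "t < 0")
    case True
    show thesis by (rule that[of z "- t"]) (use z t True in auto)
  next
    case False
    show thesis
    proof (rule that[of "- z" t])
      show "N (- z) = 0" using z(1) linear_neg[OF linear_N] by simp
      show "- z \<in> span (Phi y)" using z(2) by (rule span_neg)
      show "- z \<notin> span (Phi e)" using z(3) span_neg by fastforce
      show "- z - t *\<^sub>R p \<in> span (Phi e)" using span_neg[OF t] by simp
      show "t > 0" using False \<open>t \<noteq> 0\<close> by simp
    qed
  qed
  obtain t2 k where k: "k \<in> K" "z' - \<alpha> *\<^sub>R p + t2 *\<^sub>R p2 - k \<in> span (Phi d)"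
    using pred_face_reach[OF pd p2 z'(5)] by blast
  have "k + \<alpha> *\<^sub>R p \<in> K" using k z'(4) p(1) Phi_subset by (intro add_K scale_K) auto
  moreover have "z' + t2 *\<^sub>R p2 - (k + \<alpha> *\<^sub>R p) \<in> span (Phi d)"
    using k(2) by (simp add: algebra_simps)
  moreover have "p2 \<in> Phi y" "d \<in> Phi y" using p2 d e Phi_trans by blast+
  moreover have "gen z'" using z'(1) unfolding gen_def by (auto intro!: exI[of _ 1])
  moreover have "N z' \<in> span (Phi d)" using z'(1) by (simp add: span_zero)
  ultimately obtain q t0 s where q: "q \<in> inv_gen" "q \<in> Phi y" "q = z' + t0 *\<^sub>R p2 + s"
      "s \<in> span (Phi d)" "p2 \<notin> Phi q"
    using exists_boundary_inv_gen[OF cq y d(1) _ _ p2(2-4) z'(2)] by metis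
  have "y \<notin> Phi q" using q(5) \<open>p2 \<in> Phi y\<close> Phi_trans by blast
  then have "q \<in> span (Phi e)" using pr q by (auto simp: pred_face_def intro: span_base)
  moreover have "s \<in> span (Phi e)" using q(4) span_mono[OF Phi_mono[OF d(2)]] by blast
  moreover have "t0 *\<^sub>R p2 \<in> span (Phi e)" using p2(1) by (intro span_scale span_base)
  ultimately have "q - s - t0 *\<^sub>R p2 \<in> span (Phi e)" by (intro span_diff)
  then show False using z'(3) q(3) by simp
qed

lemma one_dim_null_if_comparable:
  assumes cq: "closed_quotients"
    and chain: "\<And>x y. x \<in> inv_gen \<Longrightarrow> y \<in> inv_gen \<Longrightarrow> x \<in> Phi y \<or> y \<in> Phi x"
    and top: "x0 \<in> inv_gen" "\<And>z. N z = 0 \<Longrightarrow> z \<in> span (Phi x0)"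
    and uv: "N u = 0" "N v = 0" "u \<noteq> 0"
  shows "\<exists>\<alpha>. v = \<alpha> *\<^sub>R u"
proof (cases "v = 0")
  case True
  then show ?thesis by (auto intro: exI[of _ 0])
next
  case False
  have *: "\<exists>y. pred_face 0 y \<and> z \<in> span (Phi y)" if z: "N z = 0" "z \<noteq> 0" for z
  proof -
    define P where "P y \<longleftrightarrow> y \<in> inv_gen \<and> z \<in> span (Phi y)" for y
    have "P x0" using top z by (auto simp: P_def)
    then obtain y where y: "P y" "\<And>w. P w \<Longrightarrow> dim (Phi y) \<le> dim (Phi w)"
      using ex_has_least_nat[of P x0 "\<lambda>y. dim (Phi y)"] by blast
    have "y \<noteq> 0" using y(1) z by (auto simp: P_def Phi_zero)
    then obtain e where e: "pred_face e y" using exists_pred_face[OF chain] y(1) by (auto simp: P_def)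
    have "Phi e \<subset> Phi y"
      using e Phi_mono self_in_Phi by (auto simp: pred_face_def inv_gen_def)
    then have "dim (Phi e) < dim (Phi y)"
      using e by (intro Phi_psubset_dim) (auto simp: pred_face_def inv_gen_def)
    then have "\<not> P e" using y(2)[of e] by auto
    then have "z \<notin> span (Phi e)" using e by (auto simp: P_def pred_face_def)
    then have "e = 0" using eigenvector_pred_face_zero[OF cq chain e z(1)] y(1) by (auto simp: P_def)
    then show ?thesis using e y(1) by (auto simp: P_def)
  qed
  obtain y1 where y1: "pred_face 0 y1" "u \<in> span (Phi y1)" using * uv by blast
  obtain y2 where y2: "pred_face 0 y2" "v \<in> span (Phi y2)" using * uv False by blast
  have i: "y1 \<in> inv_gen" "y2 \<in> inv_gen" using y1 y2 by (auto simp: pred_face_def)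
  have n: "y1 \<notin> Phi 0" "y2 \<notin> Phi 0" using y1 y2 by (auto simp: pred_face_def)
  have "y2 \<in> Phi y1" using chain[OF i] n y1(1) y2(1) i by (auto simp: pred_face_def)
  then have v1: "v \<in> span (Phi y1)" using y2(2) span_mono[OF Phi_mono] by blast
  obtain p where p: "p \<in> Phi y1" "p \<notin> Phi 0" "gen p" "N p \<in> span (Phi 0)"
    using exists_eigen_mod[OF cq i(1) inv_gen_zero _ n(1)] i zero_Phi by (auto simp: inv_gen_def)
  have g: "gen u" "gen v" using uv unfolding gen_def by (auto intro!: exI[of _ 1])
  obtain t where t: "u + t *\<^sub>R p \<in> span (Phi 0)"
    using pred_face_eigen_mod_unique[OF cq y1(1) p y1(2) g(1)] uv span_zero by metis
  obtain t' where t': "v + t' *\<^sub>R p \<in> span (Phi 0)"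
    using pred_face_eigen_mod_unique[OF cq y1(1) p v1 g(2)] uv span_zero by metis
  have eq: "u = - t *\<^sub>R p" "v = - t' *\<^sub>R p" using t t' by (auto simp: Phi_zero eq_neg_iff_add_eq_0)
  then have "t \<noteq> 0" using uv by auto
  then have "v = (t' / t) *\<^sub>R u" using eq by simp
  then show ?thesis by blast
qed

lemma interior_add: "x \<in> interior K \<Longrightarrow> y \<in> K \<Longrightarrow> x + y \<in> interior K"
proof -
  assume x: "x \<in> interior K" and y: "y \<in> K"
  have "(+) y ` interior K \<subseteq> interior K"
    using y interior_subset[of K]
    by (intro interior_maximal open_translation open_interior) (auto intro: add_K)
  then show ?thesis using x by (auto simp: add.commute)
qed

lemma interior_scale: "x \<in> interior K \<Longrightarrow> c > 0 \<Longrightarrow> c *\<^sub>R x \<in> interior K"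
proof -
  assume x: "x \<in> interior K" and c: "c > 0"
  have "(*\<^sub>R) c ` interior K \<subseteq> interior K"
    using c interior_subset[of K]
    by (intro interior_maximal open_scaling open_interior) (auto intro: scale_K)
  then show ?thesis using x by auto
qed

lemma interior_order_unit:
  assumes "k \<in> interior K"
  obtains c where "c > 0" "c *\<^sub>R k - v \<in> interior K" "c *\<^sub>R k + v \<in> interior K"
proof -
  obtain e where e: "e > 0" "ball k e \<subseteq> interior K" using assms open_contains_ball by blast
  define a where "a = e / (2 * (norm v + 1))"
  have a: "a > 0" using e by (simp add: a_def add_nonneg_pos)
  have "a * norm v < e"
  proof -
    have "a * norm v \<le> a * (norm v + 1)" using a by (intro mult_left_mono) auto
    also have "\<dots> = e / 2" unfolding a_def by (simp add: field_simps add_nonneg_eq_0_iff)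
    finally show ?thesis using e by simp
  qed
  then have "k - a *\<^sub>R v \<in> interior K" "k + a *\<^sub>R v \<in> interior K"
    using e(2) a by (auto simp: subset_iff dist_norm)
  then have "(1 / a) *\<^sub>R (k - a *\<^sub>R v) \<in> interior K" "(1 / a) *\<^sub>R (k + a *\<^sub>R v) \<in> interior K"
    using a by (auto intro!: interior_scale simp del: scaleR_right_diff_distrib)
  then show thesis using that[of "1 / a"] a by (simp add: scaleR_diff_right scaleR_add_right)
qed

text \<open>The solution \<open>w\<close> of \<open>\<mu> w - f w = k\<close> depends continuously on \<open>\<mu> > lam\<close>; the set of \<open>\<mu>\<close> with
  \<open>w \<in> K\<close> is closed and, since \<open>w \<in> K\<close> forces \<open>w \<in> interior K\<close>, also open.\<close>

lemma resolvent_positive: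
  assumes noeig: "\<And>\<mu> v. \<mu> > lam \<Longrightarrow> f v = \<mu> *\<^sub>R v \<Longrightarrow> v = 0" and k: "k \<in> interior K" and "\<mu> > lam"
  obtains w where "w \<in> K" "\<mu> *\<^sub>R w - f w = k"
proof -
  define G where "G \<mu> w = \<mu> *\<^sub>R w - f w" for \<mu> w
  have lin: "linear (G \<mu>)" for \<mu> unfolding G_def[abs_def]
    using linear_f by (intro linear_compose_sub) (auto intro: linear_compose_scale_right)
  have ker: "G \<mu> v = 0 \<Longrightarrow> v = 0" if "\<mu> > lam" for \<mu> v
    using noeig[OF that, of v] by (simp add: G_def)
  then have "inj (G \<mu>)" if "\<mu> > lam" for \<mu> using lin that by (metis linear_injective_0)
  then have surj: "surj (G \<mu>)" if "\<mu> > lam" for \<mu>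
    using linear_injective_imp_surjective[OF lin] that by blast
  define w where "w \<mu> = (SOME w. G \<mu> w = k)" for \<mu>
  have w: "G \<mu> (w \<mu>) = k" if "\<mu> > lam" for \<mu>
    unfolding w_def using surj[OF that] by (metis (mono_tags) someI_ex surjD)
  have cont: "continuous_on {lam<..} w"
    unfolding continuous_on_sequentially
  proof (intro allI ballI impI, elim conjE)
    fix m a assume a: "a \<in> {lam<..}" and m: "\<forall>n. m n \<in> {lam<..}" and lim: "m \<longlonglongrightarrow> a"
    have d0: "(\<lambda>n. m n - a) \<longlonglongrightarrow> 0" using lim by (simp add: LIM_zero)
    have eq: "(m n - a) *\<^sub>R w (m n) + G a (w (m n)) = k" for n
      using w[of "m n"] m by (simp add: G_def algebra_simps)
    have "bounded (range (\<lambda>n. w (m n)))"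
    proof (rule ccontr)
      assume "\<not> ?thesis"
      then obtain z where "z \<noteq> 0" "G a z = 0"
        using unbounded_resolvent_imp_null_vector[OF lin closed_UNIV _ _ eq d0] by (auto simp: conic_def)
      then show False using ker a by auto
    qed
    then obtain B where B: "\<And>n. norm (w (m n)) \<le> B" by (auto simp: bounded_iff)
    obtain e where e: "e > 0" "\<And>v. norm (G a v) \<ge> e * norm v"
      using injective_imp_isometric[of UNIV "G a"] lin ker a
      by (auto simp: linear_conv_bounded_linear)
    have le: "norm (w (m n) - w a) \<le> norm (m n - a) * (B / e)" for n
    proof -
      have "G a (w (m n) - w a) = - ((m n - a) *\<^sub>R w (m n))"
        unfolding linear_diff[OF lin] using eq[of n, symmetric] w[of a] a by simp
      then have "e * norm (w (m n) - w a) \<le> norm (m n - a) * norm (w (m n))"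
        using e(2)[of "w (m n) - w a"] by simp
      also have "\<dots> \<le> norm (m n - a) * B" using B by (intro mult_left_mono) auto
      finally show ?thesis using e(1) by (simp add: field_simps)
    qed
    have "(\<lambda>n. norm (m n - a) * (B / e)) \<longlonglongrightarrow> 0"
      using tendsto_mult[OF tendsto_norm_zero[OF d0] tendsto_const[of "B / e"]] by simp
    then have "(\<lambda>n. w (m n) - w a) \<longlonglongrightarrow> 0"
      by (rule Lim_null_comparison[OF always_eventually[OF allI[OF le]]])
    then show "(w \<circ> m) \<longlonglongrightarrow> w a" by (simp add: LIM_zero_cancel o_def)
  qed
  define S where "S = {lam<..} \<inter> w -` K"
  have "S = {lam<..} \<inter> w -` interior K"
  proof -
    have "w \<mu> \<in> interior K" if "\<mu> > lam" "w \<mu> \<in> K" for \<mu>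
    proof -
      have "\<mu> *\<^sub>R w \<mu> = k + f (w \<mu>)" using w[OF that(1)] by (simp add: G_def algebra_simps)
      then have "\<mu> *\<^sub>R w \<mu> \<in> interior K" using k f_in_K that(2) interior_add by simp
      then have "(1 / \<mu>) *\<^sub>R (\<mu> *\<^sub>R w \<mu>) \<in> interior K"
        using that(1) lam_nonneg interior_scale[of "\<mu> *\<^sub>R w \<mu>" "1 / \<mu>"] by simp
      moreover have "(1 / \<mu>) *\<^sub>R (\<mu> *\<^sub>R w \<mu>) = w \<mu>" using that(1) lam_nonneg by simp
      ultimately show ?thesis by metis
    qed
    then show ?thesis using interior_subset by (auto simp: S_def)
  qed
  then have "openin (top_of_set {lam<..}) S"
    using continuous_openin_preimage_gen[OF cont open_interior] by simp
  moreover have "closedin (top_of_set {lam<..}) S"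
    unfolding S_def using cont closed_K by (rule continuous_closedin_preimage)
  ultimately have "S = {} \<or> S = {lam<..}"
    using connected_clopen[of "{lam<..}"] by auto
  moreover have "S \<noteq> {}"
  proof -
    obtain B where B: "B > 0" "\<And>v. norm (f v) \<le> B * norm v"
      using linear_bounded_pos[OF linear_f] by blast
    obtain e where e: "e > 0" "ball k e \<subseteq> K" using k mem_interior by blast
    define m where "m = lam + B + B * norm k / e + 1"
    have m: "m > lam" "m - B > B * norm k / e" using B e lam_nonneg by (auto simp: m_def add_nonneg_pos add_pos_nonneg)
    have mB: "m - B > 0" using m(2) B e by (smt (verit) divide_nonneg_pos mult_nonneg_nonneg norm_ge_zero)
    have eq: "m *\<^sub>R w m = k + f (w m)" using w[OF m(1)] by (simp add: G_def algebra_simps)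
    have "m * norm (w m) = norm (k + f (w m))" using m(1) lam_nonneg unfolding eq[symmetric] by simp
    then have "m * norm (w m) \<le> norm k + B * norm (w m)"
      using norm_triangle_ineq[of k "f (w m)"] B(2)[of "w m"] by linarith
    then have 1: "(m - B) * norm (w m) \<le> norm k" by (simp add: algebra_simps)
    have "norm (f (w m)) < e"
    proof -
      have "(m - B) * norm (f (w m)) \<le> (m - B) * (B * norm (w m))" using B(2) mB by (intro mult_left_mono) auto
      also have "\<dots> = B * ((m - B) * norm (w m))" by simp
      also have "\<dots> \<le> B * norm k" using 1 B(1) by (intro mult_left_mono) auto
      also have "\<dots> < (m - B) * e" using m(2) e(1) by (simp add: field_simps)
      finally show ?thesis using mB by simp
    qed
    then have "k + f (w m) \<in> K" using e(2) by (auto simp: subset_iff dist_norm)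
    then have "(1 / m) *\<^sub>R (m *\<^sub>R w m) \<in> K" unfolding eq using m(1) lam_nonneg by (intro scale_K) auto
    then have "w m \<in> K" using m(1) lam_nonneg by simp
    then show ?thesis using m(1) by (auto simp: S_def)
  qed
  ultimately have "w \<mu> \<in> K" using assms(3) by (auto simp: S_def)
  then show thesis using that w[OF assms(3)] by (simp add: G_def)
qed

lemma null_in_span_top:
  assumes cq: "closed_quotients" and top: "x0 \<in> inv_gen" "\<And>v. v \<in> K \<Longrightarrow> gen v \<Longrightarrow> v \<in> Phi x0"
    and noeig: "\<And>\<mu> v. \<mu> > lam \<Longrightarrow> f v = \<mu> *\<^sub>R v \<Longrightarrow> v = 0"
    and "interior K \<noteq> {}" and z: "N z = 0"
  shows "z \<in> span (Phi x0)"
proof -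
  obtain k0 where k0: "k0 \<in> interior K" using assms(5) by blast
  obtain c where c: "c > 0" "c *\<^sub>R k0 - z \<in> interior K" "c *\<^sub>R k0 + z \<in> interior K"
    using interior_order_unit[OF k0] by blast
  define k where "k = c *\<^sub>R k0"
  have k: "k \<in> interior K" "k - z \<in> interior K" "k + z \<in> interior K"
    using c k0 interior_scale by (auto simp: k_def)
  have kK: "k \<in> K" using k(1) interior_subset by blast
  have PhiK: "Phi k = K"
  proof
    show "K \<subseteq> Phi k"
    proof
      fix v assume v: "v \<in> K"
      obtain b where "b > 0" "b *\<^sub>R k - v \<in> interior K" using interior_order_unit[OF k(1)] by blast
      then show "v \<in> Phi k" using v interior_subset unfolding Phi_def by (auto intro!: exI[of _ b])
    qed
  qed (rule Phi_subset)
  have x0: "x0 \<in> K" using top by (auto simp: inv_gen_def)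
  have mu: "lam + step n > lam" for n using step_pos by simp
  have ex: "\<exists>w\<in>K. (lam + step n) *\<^sub>R w - f w = y" if "y \<in> interior K" for n y
    by (rule resolvent_positive[where \<mu> = "lam + step n", OF _ that mu]) (use noeig in blast)+
  obtain w where w: "\<And>n. w n \<in> K" "\<And>n. (lam + step n) *\<^sub>R w n - f (w n) = k"
    using ex[OF k(1)] by metis
  have weq: "step n *\<^sub>R w n + N (w n) = k" for n using w(2)[of n] by (simp add: N_def algebra_simps)
  have fz: "f z = lam *\<^sub>R z" using z by (simp add: N_def)
  have unique: "u = v" if "(lam + step n) *\<^sub>R u - f u = (lam + step n) *\<^sub>R v - f v" for u v n
    using noeig[OF mu, of "u - v" n] that linear_diff[OF linear_f] by (simp add: algebra_simps)
  have pm: "w n + (1 / step n) *\<^sub>R z \<in> K" "w n - (1 / step n) *\<^sub>R z \<in> K" for n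
  proof -
    have s: "step n \<noteq> 0" using step_pos[of n] by simp
    obtain u where u: "u \<in> K" "(lam + step n) *\<^sub>R u - f u = k + z" using ex[OF k(3)] by blast
    have "u = w n + (1 / step n) *\<^sub>R z"
    proof (rule unique[of n])
      have "f (w n + (1 / step n) *\<^sub>R z) = f (w n) + (lam / step n) *\<^sub>R z"
        unfolding linear_add[OF linear_f] linear_scale[OF linear_f] fz by simp
      then show "(lam + step n) *\<^sub>R u - f u = (lam + step n) *\<^sub>R (w n + (1 / step n) *\<^sub>R z)
          - f (w n + (1 / step n) *\<^sub>R z)"
        using u(2) w(2)[of n, symmetric] s
        by (simp add: scaleR_add_left scaleR_add_right add_divide_distrib)
    qed
    then show "w n + (1 / step n) *\<^sub>R z \<in> K" using u by simp
    obtain u where u: "u \<in> K" "(lam + step n) *\<^sub>R u - f u = k - z" using ex[OF k(2)] by blast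
    have "u = w n - (1 / step n) *\<^sub>R z"
    proof (rule unique[of n])
      have "f (w n - (1 / step n) *\<^sub>R z) = f (w n) - (lam / step n) *\<^sub>R z"
        unfolding linear_diff[OF linear_f] linear_scale[OF linear_f] fz by simp
      then show "(lam + step n) *\<^sub>R u - f u = (lam + step n) *\<^sub>R (w n - (1 / step n) *\<^sub>R z)
          - f (w n - (1 / step n) *\<^sub>R z)"
        using u(2) w(2)[of n, symmetric] s
        by (simp add: scaleR_add_left scaleR_diff_right add_divide_distrib)
    qed
    then show "w n - (1 / step n) *\<^sub>R z \<in> K" using u by simp
  qed
  obtain Q where Q: "linear Q" "\<And>v. Q v = 0 \<longleftrightarrow> v \<in> span (Phi x0)" "\<And>v. v - Q v \<in> span (Phi x0)"
    by (rule exists_mod_projection) (rule that)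
  have cl: "closed (Q ` K)" using cq Q(1) by (simp add: closed_quotients_def)
  have "bounded (range (\<lambda>n. Q (w n)))"
    by (rule resolvent_bounded_mod[OF kK top(1) _ _ Q cl _ weq])
      (use x0 PhiK top(2) w(1) in auto)
  then obtain B where B: "\<And>n. norm (Q (w n)) \<le> B" by (auto simp: bounded_iff)
  obtain \<kappa> where kp: "\<kappa> > 0" "\<And>u v. u \<in> K \<Longrightarrow> v - u \<in> K \<Longrightarrow> norm (Q u) \<le> \<kappa> * norm (Q v)"
    by (rule normal_image_mod[OF x0 Q(1,2) cl]) (rule that)
  have "norm (Q z) \<le> step n * (\<kappa> * (2 * B) + B)" for n
  proof -
    have "norm (Q (w n + (1 / step n) *\<^sub>R z)) \<le> \<kappa> * norm (Q (2 *\<^sub>R w n))"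
      using pm[of n] by (intro kp(2)) (auto simp: algebra_simps scaleR_2)
    also have "\<dots> \<le> \<kappa> * (2 * B)" using kp(1) B[of n] Q(1) by (simp add: linear_scale)
    finally have "norm (Q (w n) + (1 / step n) *\<^sub>R Q z) \<le> \<kappa> * (2 * B)"
      using Q(1) by (simp add: linear_add linear_scale)
    then have "norm ((1 / step n) *\<^sub>R Q z) \<le> \<kappa> * (2 * B) + B"
      using norm_triangle_ineq4[of "Q (w n) + (1 / step n) *\<^sub>R Q z" "Q (w n)"] B[of n] by simp
    then show ?thesis using step_pos[of n] by (simp add: field_simps)
  qed
  moreover have "(\<lambda>n. step n * (\<kappa> * (2 * B) + B)) \<longlonglongrightarrow> 0 * (\<kappa> * (2 * B) + B)"
    by (intro tendsto_mult step_tendsto tendsto_const)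
  ultimately have "norm (Q z) \<le> 0"
    by (intro tendsto_lowerbound[of "\<lambda>n. step n * (\<kappa> * (2 * B) + B)" 0 sequentially]) auto
  then show ?thesis using Q(2) by simp
qed

subsection \<open>Polyhedral cones\<close>

lemma exists_max_subtraction:
  assumes "v \<in> K" "y \<in> K" "y \<noteq> 0"
  obtains t where "t \<ge> 0" "v - t *\<^sub>R y \<in> K" "y \<notin> Phi (v - t *\<^sub>R y)"
proof -
  define T where "T = {t. v - t *\<^sub>R y \<in> K}"
  obtain \<kappa> where k: "\<kappa> > 0" "\<And>u v. u \<in> K \<Longrightarrow> v - u \<in> K \<Longrightarrow> norm u \<le> \<kappa> * norm v"
    by (rule normal_K) (rule that)
  have "T = (\<lambda>t. v - t *\<^sub>R y) -` K" by (auto simp: T_def)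
  then have cl: "closed T" using closed_K by (auto intro!: continuous_closed_vimage continuous_intros)
  have ne: "0 \<in> T" using assms by (simp add: T_def)
  have "t \<le> \<kappa> * norm v / norm y" if "t \<in> T" for t
  proof (cases "t \<ge> 0")
    case True
    have "norm (t *\<^sub>R y) \<le> \<kappa> * norm v"
      using True that assms by (intro k(2) scale_K) (auto simp: T_def)
    then show ?thesis using True assms(3) by (simp add: field_simps)
  next
    case False
    have "0 \<le> \<kappa> * norm v / norm y" using k(1) by simp
    then show ?thesis using False by linarith
  qed
  then have bdd: "bdd_above T" by (intro bdd_aboveI)
  define t where "t = Sup T"
  have tT: "t \<in> T" unfolding t_def using cl ne bdd by (intro closed_contains_Sup) auto
  have "t \<ge> 0" unfolding t_def using ne bdd by (rule cSup_upper)
  moreover have "y \<notin> Phi (v - t *\<^sub>R y)"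
  proof
    assume "y \<in> Phi (v - t *\<^sub>R y)"
    then obtain c where c: "c \<ge> 0" "c *\<^sub>R (v - t *\<^sub>R y) - y \<in> K" by (auto simp: Phi_def)
    have "c \<noteq> 0" using c(2) assms pointed by auto
    then have "(1 / c) *\<^sub>R (c *\<^sub>R (v - t *\<^sub>R y) - y) \<in> K" using c by (intro scale_K) auto
    moreover have "(1 / c) *\<^sub>R (c *\<^sub>R (v - t *\<^sub>R y) - y) = v - (t + 1 / c) *\<^sub>R y"
      using \<open>c \<noteq> 0\<close> by (simp add: scaleR_diff_right scaleR_add_left)
    ultimately have "t + 1 / c \<in> T" by (simp add: T_def)
    then have "t + 1 / c \<le> t" unfolding t_def using bdd by (intro cSup_upper)
    then show False using c(1) \<open>c \<noteq> 0\<close> by simp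
  qed
  ultimately show thesis using that tT by (auto simp: T_def)
qed

lemma eigenvectors_parallel_if_comparable:
  assumes comp: "\<And>u v. u \<in> K \<Longrightarrow> N u = 0 \<Longrightarrow> u \<noteq> 0 \<Longrightarrow> v \<in> K \<Longrightarrow> N v = 0 \<Longrightarrow> v \<noteq> 0 \<Longrightarrow> u \<in> Phi v \<or> v \<in> Phi u"
    and x: "x \<in> K" "N x = 0" "x \<noteq> 0" and y: "y \<in> K" "N y = 0"
  shows "\<exists>\<alpha>. y = \<alpha> *\<^sub>R x"
proof -
  obtain t where t: "t \<ge> 0" "y - t *\<^sub>R x \<in> K" "x \<notin> Phi (y - t *\<^sub>R x)"
    using exists_max_subtraction[OF y(1) x(1,3)] by blast
  define y' where "y' = y - t *\<^sub>R x"
  have y': "y' \<in> K" "N y' = 0" "x \<notin> Phi y'"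
    using t x y linear_diff[OF linear_N] linear_scale[OF linear_N] by (auto simp: y'_def)
  show ?thesis
  proof (cases "y' = 0")
    case True
    then show ?thesis by (auto simp: y'_def)
  next
    case False
    obtain s where s: "s \<ge> 0" "x - s *\<^sub>R y' \<in> K" "y' \<notin> Phi (x - s *\<^sub>R y')"
      using exists_max_subtraction[OF x(1) y'(1) False] by blast
    define x' where "x' = x - s *\<^sub>R y'"
    have x': "x' \<in> K" "N x' = 0" "y' \<notin> Phi x'"
      using s x y' linear_diff[OF linear_N] linear_scale[OF linear_N] by (auto simp: x'_def)
    have sy: "s *\<^sub>R y' \<in> Phi y'" using s(1) y' self_in_Phi scale_Phi by blast
    have "x' \<noteq> 0" using sy y'(3) by (auto simp: x'_def)
    then have "x' \<in> Phi y'" using comp[OF x'(1,2) _ y'(1,2) False] x'(3) by blast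
    then have "x' + s *\<^sub>R y' \<in> Phi y'" using sy y'(1) add_Phi by blast
    then show ?thesis using y'(3) by (simp add: x'_def)
  qed
qed

lemma in_hull_extreme_rays:
  assumes "x \<in> K"
  shows "x \<in> convex_cone hull {v \<in> K. dim (Phi v) = 1}"
  using assms
proof (induction "dim (Phi x)" arbitrary: x rule: less_induct)
  case less
  let ?H = "convex_cone hull {v \<in> K. dim (Phi v) = 1}"
  show ?case
  proof (cases "dim (Phi x) \<le> 1")
    case True
    show ?thesis
    proof (cases "dim (Phi x) = 1")
      case True
      then show ?thesis using less.prems by (intro hull_inc) auto
    next
      case False
      then have "dim (Phi x) = 0" using \<open>dim (Phi x) \<le> 1\<close> by linarith
      then have "Phi x \<subseteq> {0}" using dim_eq_0 by blast
      then have "x = 0" using self_in_Phi[OF less.prems] by auto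
      then show ?thesis using convex_cone_hull_contains_0 by simp
    qed
  next
    case False
    have "\<not> Phi x \<subseteq> span {x}"
    proof
      assume "Phi x \<subseteq> span {x}"
      then have "dim (Phi x) \<le> card {x}" by (intro dim_le_card) auto
      then show False using False by simp
    qed
    then obtain y0 where y0: "y0 \<in> Phi x" "y0 \<notin> span {x}" by blast
    have "x \<noteq> 0"
    proof
      assume "x = 0"
      then show False using y0 Phi_zero by (auto simp: span_zero)
    qed
    have y0K: "y0 \<in> K" using y0 Phi_subset by blast
    obtain t where t: "t \<ge> 0" "y0 - t *\<^sub>R x \<in> K" "x \<notin> Phi (y0 - t *\<^sub>R x)"
      using exists_max_subtraction[OF y0K less.prems \<open>x \<noteq> 0\<close>] by blast
    define y where "y = y0 - t *\<^sub>R x"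
    have "y \<noteq> 0" using y0(2) span_scale[OF span_base[of x "{x}"], of t] by (auto simp: y_def)
    have sub: "u - s *\<^sub>R v \<in> Phi u" if "u - s *\<^sub>R v \<in> K" "s \<ge> 0" "v \<in> K" for u v s
      using that scale_K[OF that(3,2)] by (auto simp: Phi_def intro!: exI[of _ 1])
    have y: "y \<in> K" "y \<in> Phi x" "x \<notin> Phi y"
      using t sub[OF t(2,1) less.prems] y0(1) Phi_trans by (auto simp: y_def)
    obtain s where s: "s \<ge> 0" "x - s *\<^sub>R y \<in> K" "y \<notin> Phi (x - s *\<^sub>R y)"
      using exists_max_subtraction[OF less.prems y(1) \<open>y \<noteq> 0\<close>] by blast
    define x' where "x' = x - s *\<^sub>R y"
    have x': "x' \<in> K" "x' \<in> Phi x" "x \<notin> Phi x'"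
      using s sub[OF s(2,1) y(1)] y(2) Phi_trans by (auto simp: x'_def)
    have IH: "v \<in> ?H" if "v \<in> K" "v \<in> Phi x" "x \<notin> Phi v" for v
    proof (rule less.hyps)
      have "Phi v \<subset> Phi x" using that Phi_mono self_in_Phi[OF less.prems] by blast
      then show "dim (Phi v) < dim (Phi x)" using that less.prems by (intro Phi_psubset_dim)
    qed fact
    have "x' + s *\<^sub>R y \<in> ?H"
      using IH[OF x'] IH[OF y] s(1) by (intro convex_cone_hull_add convex_cone_hull_mul)
    then show ?thesis by (simp add: x'_def)
  qed
qed

lemma closed_quotients_if_finite_rays:
  assumes "finite {Phi v |v. v \<in> K \<and> dim (Phi v) = 1}"
  shows "closed_quotients"
proof -
  let ?E = "{v \<in> K. dim (Phi v) = 1}"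
  define \<F> where "\<F> = {Phi v |v. v \<in> ?E}"
  define r where "r F = (SOME v. v \<in> K \<and> Phi v = F)" for F
  have r: "r F \<in> K \<and> Phi (r F) = F" if "F \<in> \<F>" for F
  proof -
    have "\<exists>v. v \<in> K \<and> Phi v = F" using that unfolding \<F>_def by blast
    then show ?thesis unfolding r_def by (rule someI_ex)
  qed
  define S where "S = r ` \<F>"
  have "finite S" using assms by (simp add: S_def \<F>_def)
  have SK: "S \<subseteq> K" using r by (auto simp: S_def)
  have "?E \<subseteq> convex_cone hull S"
  proof
    fix v assume v: "v \<in> ?E"
    then have F: "Phi v \<in> \<F>" by (auto simp: \<F>_def)
    define u where "u = r (Phi v)"
    have u: "u \<in> K" "Phi v = Phi u" using r[OF F] by (auto simp: u_def)
    have uv: "u \<in> Phi v" "v \<in> Phi v" using u self_in_Phi v by auto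
    have "u \<noteq> 0"
    proof
      assume "u = 0"
      then have "Phi v \<subseteq> {0}" using u Phi_zero by simp
      then have "dim (Phi v) = 0" using dim_eq_0 by blast
      then show False using v by (metis (mono_tags, lifting) mem_Collect_eq zero_neq_one)
    qed
    have "Phi v \<subseteq> span {u}"
      using card_ge_dim_independent[of "{u}" "Phi v"] uv(1) v \<open>u \<noteq> 0\<close> by simp
    then obtain c where c: "v = c *\<^sub>R u" using uv(2) by (auto simp: span_singleton)
    have "c \<ge> 0"
    proof (rule ccontr)
      assume "\<not> c \<ge> 0"
      then have "(- (1 / c)) *\<^sub>R v \<in> K" using v by (intro scale_K) auto
      then have "- u \<in> K" using c \<open>\<not> c \<ge> 0\<close> by simp
      then show False using pointed u(1) \<open>u \<noteq> 0\<close> by blast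
    qed
    moreover have "u \<in> S" using F by (auto simp: S_def u_def)
    ultimately show "v \<in> convex_cone hull S" unfolding c
      by (intro convex_cone_hull_mul hull_inc)
  qed
  then have "convex_cone hull ?E \<subseteq> convex_cone hull S"
    by (intro hull_minimal convex_cone_convex_cone_hull)
  then have "K \<subseteq> convex_cone hull S" using in_hull_extreme_rays by blast
  moreover have "convex_cone hull S \<subseteq> K" using SK cone_K by (rule hull_minimal)
  ultimately have K: "K = convex_cone hull S" by blast
  have "closed (Q ` K)" if "linear Q" for Q :: "'a \<Rightarrow> 'a"
  proof -
    have "Q ` K = convex_cone hull (Q ` S)"
      unfolding K using that by (rule convex_cone_hull_linear_image[symmetric])
    then show ?thesis using closed_convex_cone_hull[of "Q ` S"] \<open>finite S\<close> by simp
  qed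
  then show ?thesis by (simp add: closed_quotients_def)
qed

end

section \<open>Invariant faces of a proper cone\<close>

locale cone_matrix =
  fixes K :: "(real ^ 'n) set" and A :: "real ^ 'n ^ 'n" and lam :: real
  assumes proper: "proper_cone K" and preserving: "A \<in> cone_preserving K"
    and distinguished: "distinguished_eigenvalue K A lam"

sublocale cone_matrix \<subseteq> cone_map K "(*v) A" lam
proof (intro cone_map.intro)
  show "closed K" "convex_cone K" using proper by (auto simp: proper_cone_def)
  show pt: "x = 0" if "x \<in> K" "- x \<in> K" for x
  proof -
    have "x \<in> K \<inter> uminus ` K" using that by (auto intro: image_eqI[of _ _ "- x"])
    then show ?thesis using proper by (auto simp: proper_cone_def)
  qed
  show "linear ((*v) A)" by simp
  show fK: "A *v x \<in> K" if "x \<in> K" for x using preserving that by (auto simp: cone_preserving_def)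
  show "0 \<le> lam"
  proof (rule ccontr)
    assume neg: "\<not> 0 \<le> lam"
    obtain x where x: "x \<in> K" "x \<noteq> 0" "A *v x = lam *\<^sub>R x"
      using distinguished by (auto simp: distinguished_eigenvalue_def)
    have "(- 1 / lam) *\<^sub>R (lam *\<^sub>R x) \<in> K"
    proof (rule convex_cone_scaleR)
      show "convex_cone K" using proper by (simp add: proper_cone_def)
      show "lam *\<^sub>R x \<in> K" using fK[OF x(1)] x(3) by simp
    qed (use neg in simp)
    moreover have "(- 1 / lam) *\<^sub>R (lam *\<^sub>R x) = - x" using neg by simp
    ultimately have "- x \<in> K" by metis
    then show False using pt x by blast
  qed
qed

context cone_matrix
begin

lemma rel_interior_imp_eq_Phi:
  assumes "cone_face K F" "x \<in> rel_interior F"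
  shows "x \<in> K \<and> F = Phi x"
proof -
  have F: "convex_cone F" "F \<subseteq> K" "\<And>u v. u \<in> K \<Longrightarrow> v \<in> K \<Longrightarrow> u + v \<in> F \<Longrightarrow> u \<in> F"
    using assms(1) by (auto simp: cone_face_def)
  have x: "x \<in> F" using assms(2) rel_interior_subset by blast
  have "Phi x \<subseteq> F"
  proof
    fix v assume "v \<in> Phi x"
    then obtain c where c: "c \<ge> 0" "c *\<^sub>R x - v \<in> K" "v \<in> K" by (auto simp: Phi_def)
    have "v + (c *\<^sub>R x - v) \<in> F" using convex_cone_scaleR[OF F(1) c(1) x] by simp
    then show "v \<in> F" using F(3) c by blast
  qed
  moreover have "F \<subseteq> Phi x"
  proof
    fix v assume v: "v \<in> F"
    then obtain c where "c > 0" "c *\<^sub>R x - v \<in> F"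
      using rel_interior_order_unit[OF F(1) assms(2)] by blast
    then show "v \<in> Phi x" using F(2) v unfolding Phi_def by (auto intro!: exI[of _ c])
  qed
  ultimately show ?thesis using x F(2) by blast
qed

lemma cone_face_Phi:
  assumes "x \<in> K"
  shows "cone_face K (Phi x)"
  unfolding cone_face_def
proof (intro conjI ballI impI convex_cone_Phi[OF assms] Phi_subset)
  fix u v assume uv: "u \<in> K" "v \<in> K" "u + v \<in> Phi x"
  then have "u \<in> Phi (u + v)" "v \<in> Phi (u + v)" by (auto simp: Phi_def intro: exI[of _ 1])
  then show "u \<in> Phi x" "v \<in> Phi x" using uv Phi_trans by blast+
qed

lemma rel_interior_Phi:
  assumes "x \<in> K"
  shows "x \<in> rel_interior (Phi x)"
proof -
  have cc: "convex (Phi x)" "Phi x \<noteq> {}"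
    using convex_cone_Phi[OF assms] by (auto simp: convex_cone_def)
  have "\<exists>e>1. (1 - e) *\<^sub>R v + e *\<^sub>R x \<in> Phi x" if v: "v \<in> Phi x" for v
  proof -
    obtain c where c: "c \<ge> 0" "c *\<^sub>R x - v \<in> K" "v \<in> K" using v by (auto simp: Phi_def)
    define a where "a = 1 / (c + 1)"
    have a: "a > 0" "a * (c + 1) = 1" using c(1) by (auto simp: a_def)
    have "a *\<^sub>R (c *\<^sub>R x - v) + (2 * a) *\<^sub>R x \<in> K" using a c assms by (intro add_K scale_K) auto
    also have "a *\<^sub>R (c *\<^sub>R x - v) + (2 * a) *\<^sub>R x = (a * (c + 1) + a) *\<^sub>R x - a *\<^sub>R v"
      by (simp add: algebra_simps)
    also have "\<dots> = (1 - (1 + a)) *\<^sub>R v + (1 + a) *\<^sub>R x" unfolding a(2) by simp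
    finally have "(1 - (1 + a)) *\<^sub>R v + (1 + a) *\<^sub>R x \<in> K" .
    moreover have "(1 + a) *\<^sub>R x - ((1 - (1 + a)) *\<^sub>R v + (1 + a) *\<^sub>R x) \<in> K"
      using scale_K[OF c(3), of a] a by simp
    ultimately have "(1 - (1 + a)) *\<^sub>R v + (1 + a) *\<^sub>R x \<in> Phi x"
      using a unfolding Phi_def by (auto intro!: exI[of _ "1 + a"])
    then show ?thesis using a(1) by (intro exI[of _ "1 + a"]) auto
  qed
  then show ?thesis using convex_rel_interior_iff[OF cc] by blast
qed

lemma cone_face_cases:
  assumes "cone_face K F"
  obtains x where "x \<in> K" "F = Phi x"
proof -
  have "convex F" "F \<noteq> {}" using assms by (auto simp: cone_face_def convex_cone_def)
  then obtain x where "x \<in> rel_interior F" using rel_interior_eq_empty[of F] by blast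
  then show thesis using that rel_interior_imp_eq_Phi[OF assms] by blast
qed

lemma invariant_face_Phi_iff:
  assumes "x \<in> K"
  shows "invariant_face K A (Phi x) \<longleftrightarrow> A *v x \<in> Phi x"
  unfolding invariant_face_def using cone_face_Phi[OF assms] f_Phi[OF assms] self_in_Phi[OF assms] by blast

lemma join_face_Phi:
  assumes "g \<in> K" "h \<in> K"
  shows "join_face K (Phi g) (Phi h) = Phi (g + h)"
proof
  have K: "g + h \<in> K" using assms by (rule add_K)
  have mem: "g \<in> Phi (g + h)" "h \<in> Phi (g + h)" using assms by (auto simp: Phi_def intro: exI[of _ 1])
  have "cone_face K (Phi (g + h)) \<and> \<Union>{Phi g, Phi h} \<subseteq> Phi (g + h)"
    using cone_face_Phi[OF K] mem[THEN Phi_mono] by simp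
  then show "join_face K (Phi g) (Phi h) \<subseteq> Phi (g + h)" unfolding join_faces_def by (intro Inter_lower) simp
  show "Phi (g + h) \<subseteq> join_face K (Phi g) (Phi h)"
    unfolding join_faces_def
  proof (intro Inter_greatest)
    fix H assume "H \<in> {H. cone_face K H \<and> \<Union>{Phi g, Phi h} \<subseteq> H}"
    then have H: "cone_face K H" "g \<in> H" "h \<in> H" using self_in_Phi assms by auto
    obtain x where x: "x \<in> K" "H = Phi x" using cone_face_cases[OF H(1)] by blast
    then have "g + h \<in> Phi x" using H add_Phi by blast
    then show "Phi (g + h) \<subseteq> H" using x(2) Phi_mono by blast
  qed
qed

lemma N_matrix: "(mat lam - A) *v v = N v"
proof -
  have "mat lam *v v = lam *\<^sub>R v"
    by (simp add: vec_eq_iff mat_def matrix_vector_mult_def if_distribR mult_delta_left)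
  then show ?thesis by (simp add: N_def matrix_vector_mult_diff_rdistrib)
qed

lemma null_space_iff: "x \<in> null_space (mat lam - A) \<longleftrightarrow> N x = 0"
  by (simp add: null_space_def N_matrix)

lemma generalized_eigenvector_iff: "generalized_eigenvector A lam x \<longleftrightarrow> x \<noteq> 0 \<and> gen x"
proof -
  have N: "(*v) (mat lam - A) = N" by (rule ext) (rule N_matrix)
  have "k > 0" if "x \<noteq> 0" "(N ^^ k) x = 0" for k using that by (cases k) auto
  then show ?thesis unfolding generalized_eigenvector_def gen_def N by blast
qed

lemma invariant_face_gen_iff:
  "invariant_face K A F \<and> rel_interior_gen_eigvec A lam F \<longleftrightarrow> (\<exists>x\<in>inv_gen. x \<noteq> 0 \<and> F = Phi x)"
proof
  assume F: "invariant_face K A F \<and> rel_interior_gen_eigvec A lam F"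
  then obtain x where x: "x \<in> rel_interior F" "x \<noteq> 0" "gen x"
    by (auto simp: rel_interior_gen_eigvec_def generalized_eigenvector_iff)
  have "cone_face K F" using F by (simp add: invariant_face_def)
  then have "x \<in> K" "F = Phi x" using rel_interior_imp_eq_Phi x(1) by blast+
  then show "\<exists>x\<in>inv_gen. x \<noteq> 0 \<and> F = Phi x"
    using x F invariant_face_Phi_iff by (auto simp: inv_gen_def)
next
  assume "\<exists>x\<in>inv_gen. x \<noteq> 0 \<and> F = Phi x"
  then obtain x where x: "x \<in> K" "A *v x \<in> Phi x" "gen x" "x \<noteq> 0" "F = Phi x"
    by (auto simp: inv_gen_def)
  then show "invariant_face K A F \<and> rel_interior_gen_eigvec A lam F"
    using invariant_face_Phi_iff[OF x(1)] rel_interior_Phi[OF x(1)]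
    by (auto simp: rel_interior_gen_eigvec_def generalized_eigenvector_iff)
qed

lemma invariant_join_irreducible_Phi_iff:
  assumes x: "x \<in> K" "A *v x \<in> Phi x"
  shows "invariant_join_irreducible K A (Phi x) \<longleftrightarrow> irr x"
proof
  assume L: "invariant_join_irreducible K A (Phi x)"
  show "irr x" unfolding irr_def
  proof (intro allI impI, elim conjE, rule ccontr)
    fix g h assume g: "g \<in> Phi x" "A *v g \<in> Phi g" and h: "h \<in> Phi x" "A *v h \<in> Phi h"
      and xgh: "x \<in> Phi (g + h)" and no: "\<not> (x \<in> Phi g \<or> x \<in> Phi h)"
    have K: "g \<in> K" "h \<in> K" using g h Phi_subset by auto
    have "invariant_face K A (Phi g)" "invariant_face K A (Phi h)"
      using invariant_face_Phi_iff K g h by auto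
    moreover have "Phi g \<subset> Phi x" "Phi h \<subset> Phi x" using g h no Phi_mono self_in_Phi[OF x(1)] by blast+
    moreover have "Phi x = join_face K (Phi g) (Phi h)"
      unfolding join_face_Phi[OF K] using Phi_mono[OF xgh] Phi_mono[OF add_Phi[OF x(1) g(1) h(1)]] by blast
    ultimately show False using L unfolding invariant_join_irreducible_def by blast
  qed
next
  assume irr: "irr x"
  have False if G: "invariant_face K A G" and H: "invariant_face K A H"
    and GH: "G \<subset> Phi x" "H \<subset> Phi x" "Phi x = join_face K G H" for G H
  proof -
    obtain g where g: "g \<in> K" "G = Phi g" using G cone_face_cases by (auto simp: invariant_face_def)
    obtain h where h: "h \<in> K" "H = Phi h" using H cone_face_cases by (auto simp: invariant_face_def)
    have "A *v g \<in> Phi g" "A *v h \<in> Phi h" using invariant_face_Phi_iff g h G H by auto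
    moreover have "g \<in> Phi x" "h \<in> Phi x" using GH g h self_in_Phi by blast+
    moreover have "x \<in> Phi (g + h)"
      using GH(3) self_in_Phi[OF x(1)] join_face_Phi[OF g(1) h(1)] g h by simp
    ultimately have "x \<in> Phi g \<or> x \<in> Phi h" using irr unfolding irr_def by blast
    then show False using GH g h Phi_mono by blast
  qed
  then show "invariant_join_irreducible K A (Phi x)"
    unfolding invariant_join_irreducible_def using invariant_face_Phi_iff[OF x(1)] x(2) by blast
qed

lemma semi_distinguished_assoc_iff:
  "semi_distinguished_assoc K A lam F \<longleftrightarrow> (\<exists>x\<in>inv_gen. x \<noteq> 0 \<and> irr x \<and> F = Phi x)"
proof -
  have "semi_distinguished_assoc K A lam F \<longleftrightarrow> invariant_join_irreducible K A F \<and>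
      (invariant_face K A F \<and> rel_interior_gen_eigvec A lam F)"
    by (auto simp: semi_distinguished_assoc_def invariant_join_irreducible_def)
  then show ?thesis unfolding invariant_face_gen_iff
    using invariant_join_irreducible_Phi_iff inv_genD by blast
qed

lemma cond_b_iff: "cond_b K A lam \<longleftrightarrow> (\<forall>x\<in>inv_gen. x \<noteq> 0 \<longrightarrow> irr x)"
proof
  assume b: "cond_b K A lam"
  show "\<forall>x\<in>inv_gen. x \<noteq> 0 \<longrightarrow> irr x"
  proof (intro ballI impI)
    fix x assume x: "x \<in> inv_gen" "x \<noteq> 0"
    then have "semi_distinguished K A (Phi x)"
      using b invariant_face_gen_iff unfolding cond_b_def by blast
    then have "invariant_join_irreducible K A (Phi x)"
      by (auto simp: semi_distinguished_def semi_distinguished_assoc_def)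
    then show "irr x" using invariant_join_irreducible_Phi_iff inv_genD[OF x(1)] by blast
  qed
next
  assume "\<forall>x\<in>inv_gen. x \<noteq> 0 \<longrightarrow> irr x"
  then show "cond_b K A lam"
    unfolding cond_b_def invariant_face_gen_iff semi_distinguished_def
    using semi_distinguished_assoc_iff by blast
qed

lemma Phi_subset_iff: "x \<in> K \<Longrightarrow> Phi x \<subseteq> Phi y \<longleftrightarrow> x \<in> Phi y"
  using Phi_mono self_in_Phi by blast

lemma cond_c_iff:
  "cond_c K A lam \<longleftrightarrow> (\<forall>x\<in>inv_gen. \<forall>y\<in>inv_gen. x \<in> Phi y \<or> y \<in> Phi x)"
proof -
  have "cond_c K A lam \<longleftrightarrow>
      (\<forall>x\<in>inv_gen. \<forall>y\<in>inv_gen. x \<noteq> 0 \<longrightarrow> y \<noteq> 0 \<longrightarrow> Phi x \<subseteq> Phi y \<or> Phi y \<subseteq> Phi x)"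
    unfolding cond_c_def using invariant_face_gen_iff by metis
  also have "\<dots> \<longleftrightarrow> (\<forall>x\<in>inv_gen. \<forall>y\<in>inv_gen. x \<noteq> 0 \<longrightarrow> y \<noteq> 0 \<longrightarrow> x \<in> Phi y \<or> y \<in> Phi x)"
    using Phi_subset_iff by (auto simp: inv_gen_def)
  also have "\<dots> \<longleftrightarrow> (\<forall>x\<in>inv_gen. \<forall>y\<in>inv_gen. x \<in> Phi y \<or> y \<in> Phi x)"
    using zero_Phi by (auto simp: inv_gen_def)
  finally show ?thesis .
qed

lemma cond_d_iff:
  "cond_d K A lam \<longleftrightarrow> (\<forall>x\<in>inv_gen. \<forall>y\<in>inv_gen. x \<noteq> 0 \<longrightarrow> y \<noteq> 0 \<longrightarrow> irr x \<longrightarrow> irr y \<longrightarrow>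
     x \<in> Phi y \<or> y \<in> Phi x)"
proof -
  have "cond_d K A lam \<longleftrightarrow> (\<forall>x\<in>inv_gen. \<forall>y\<in>inv_gen. x \<noteq> 0 \<longrightarrow> y \<noteq> 0 \<longrightarrow> irr x \<longrightarrow> irr y \<longrightarrow>
     Phi x \<subseteq> Phi y \<or> Phi y \<subseteq> Phi x)"
    unfolding cond_d_def semi_distinguished_assoc_iff by blast
  then show ?thesis using Phi_subset_iff by (auto simp: inv_gen_def)
qed

lemma distinguished_eigenvector: obtains x where "x \<in> K" "x \<noteq> 0" "N x = 0"
  using distinguished by (auto simp: distinguished_eigenvalue_def N_def)

lemma cond_a_iff: "cond_a A lam \<longleftrightarrow> (\<forall>u v. N u = 0 \<longrightarrow> N v = 0 \<longrightarrow> u \<noteq> 0 \<longrightarrow> (\<exists>\<alpha>. v = \<alpha> *\<^sub>R u))"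
proof -
  obtain x where "x \<in> null_space (mat lam - A)" "x \<noteq> 0"
    using distinguished_eigenvector null_space_iff by metis
  then show ?thesis
    unfolding cond_a_def dim_eq_1_iff_parallel[OF \<open>x \<in> _\<close> \<open>x \<noteq> 0\<close>] Ball_def null_space_iff by blast
qed

lemma cond_e_iff:
  "cond_e K A lam \<longleftrightarrow>
    (\<forall>u\<in>K. \<forall>v\<in>K. N u = 0 \<longrightarrow> N v = 0 \<longrightarrow> u \<noteq> 0 \<longrightarrow> (\<exists>\<alpha>. v = \<alpha> *\<^sub>R u))"
proof -
  obtain x where "x \<in> null_space (mat lam - A) \<inter> K" "x \<noteq> 0"
    using distinguished_eigenvector null_space_iff by (metis IntI)
  then show ?thesis
    unfolding cond_e_def dim_span dim_eq_1_iff_parallel[OF \<open>x \<in> _\<close> \<open>x \<noteq> 0\<close>] Ball_def Int_iff null_space_iff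
    by blast
qed

lemma cond_a_imp_b: "cond_a A lam \<Longrightarrow> cond_b K A lam"
  unfolding cond_a_iff cond_b_iff using irr_if_single_block by blast

lemma cond_b_imp_c:
  assumes "cond_b K A lam"
  shows "cond_c K A lam"
  unfolding cond_c_iff
proof (intro ballI)
  fix x y assume xy: "x \<in> inv_gen" "y \<in> inv_gen"
  show "x \<in> Phi y \<or> y \<in> Phi x"
  proof (cases "x + y = 0")
    case True
    then have "y = - x" by (simp add: add_eq_0_iff)
    then have "x = 0" using pointed xy by (auto simp: inv_gen_def)
    then show ?thesis using xy zero_Phi by (auto simp: inv_gen_def)
  next
    case False
    have K: "x \<in> K" "y \<in> K" "A *v x \<in> Phi x" "A *v y \<in> Phi y" "x + y \<in> K"
      using xy inv_genD add_K by auto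
    have mem: "x \<in> Phi (x + y)" "y \<in> Phi (x + y)" using K by (auto simp: Phi_def intro: exI[of _ 1])
    have "irr (x + y)" using assms inv_gen_add[OF xy] False unfolding cond_b_iff by blast
    then have "x + y \<in> Phi x \<or> x + y \<in> Phi y"
      using mem K self_in_Phi[OF K(5)] unfolding irr_def by blast
    then show ?thesis using mem Phi_trans by blast
  qed
qed

lemma cond_c_imp_d: "cond_c K A lam \<Longrightarrow> cond_d K A lam"
  unfolding cond_c_iff cond_d_iff by blast

lemma cond_d_imp_e:
  assumes "cond_d K A lam"
  shows "cond_e K A lam"
proof -
  let ?X = "{x \<in> K. N x = 0}"
  have X: "?X \<subseteq> inv_gen" using eigen_inv_gen by blast
  have comp: "u \<in> Phi v \<or> v \<in> Phi u"
    if "u \<in> ?X" "v \<in> ?X" "u \<noteq> 0" "v \<noteq> 0" "irr u" "irr v" for u v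
    using assms that X unfolding cond_d_iff by blast
  have "irr x" if x: "x \<in> ?X" "x \<noteq> 0" for x
  proof (rule irr_if_irr_comparable[OF X _ comp x])
    fix x g h assume "x \<in> ?X" "g \<in> Phi x" "A *v g \<in> Phi g" "h \<in> Phi x" "A *v h \<in> Phi h" "x \<in> Phi (g + h)"
    then obtain u v where "u \<in> Phi g" "N u = 0" "v \<in> Phi h" "N v = 0" "x \<in> Phi (u + v)"
      using split_eigen[of x g h] by blast
    then show "\<exists>u\<in>?X. \<exists>v\<in>?X. u \<in> Phi g \<and> v \<in> Phi h \<and> x \<in> Phi (u + v)" using Phi_subset by blast
  qed
  then have "u \<in> Phi v \<or> v \<in> Phi u"
    if "u \<in> K" "N u = 0" "u \<noteq> 0" "v \<in> K" "N v = 0" "v \<noteq> 0" for u v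
    using comp that by blast
  then show ?thesis unfolding cond_e_iff using eigenvectors_parallel_if_comparable by metis
qed

lemma cond_d_imp_b_if_joins:
  assumes joins: "\<And>F. invariant_face K A F \<Longrightarrow> rel_interior_gen_eigvec A lam F \<Longrightarrow>
      \<exists>\<F>. (\<forall>G\<in>\<F>. semi_distinguished_assoc K A lam G) \<and> F = join_faces K \<F>"
    and d: "cond_d K A lam"
  shows "cond_b K A lam"
  unfolding cond_b_def
proof (intro allI impI, elim conjE)
  fix F assume F: "invariant_face K A F" "rel_interior_gen_eigvec A lam F"
  obtain \<F> where FF: "\<And>G. G \<in> \<F> \<Longrightarrow> semi_distinguished_assoc K A lam G" "F = join_faces K \<F>"
    using joins[OF F] by blast
  obtain x where x: "x \<in> inv_gen" "x \<noteq> 0" "F = Phi x" using F invariant_face_gen_iff by blast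
  have "\<F> \<noteq> {}"
  proof
    assume "\<F> = {}"
    then have "F \<subseteq> Phi 0" using FF(2) cone_face_Phi[OF zero_K] by (auto simp: join_faces_def)
    then show False using x self_in_Phi Phi_zero by (auto simp: inv_gen_def)
  qed
  then obtain G0 where "G0 \<in> \<F>" by blast
  moreover have "\<forall>G. G \<in> \<F> \<longrightarrow> dim G < DIM(real ^ 'n) + 1" using dim_subset_UNIV[where 'a = "real ^ 'n"] by (simp add: less_Suc_eq_le)
  ultimately obtain G where G: "G \<in> \<F>" "\<And>H. H \<in> \<F> \<Longrightarrow> dim H \<le> dim G"
    using ex_has_greatest_nat[of "\<lambda>G. G \<in> \<F>" G0 dim "DIM(real ^ 'n) + 1"] by (metis (no_types, lifting) less_imp_le)
  have "H \<subseteq> G" if H: "H \<in> \<F>" for H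
  proof (rule ccontr)
    assume n: "\<not> H \<subseteq> G"
    then have sub: "G \<subset> H" using d FF(1)[OF H] FF(1)[OF G(1)] unfolding cond_d_def by blast
    obtain g h where gh: "g \<in> K" "h \<in> K" "G = Phi g" "H = Phi h"
      using FF(1)[OF H] FF(1)[OF G(1)] unfolding semi_distinguished_assoc_iff inv_gen_def by blast
    then have "dim G < dim H" using Phi_psubset_dim sub by blast
    then show False using G(2)[OF H] by simp
  qed
  moreover have "cone_face K G"
    using FF(1)[OF G(1)] by (simp add: semi_distinguished_assoc_def invariant_join_irreducible_def invariant_face_def)
  ultimately have "F \<subseteq> G" unfolding FF(2) join_faces_def by blast
  moreover have "G \<subseteq> F" unfolding FF(2) join_faces_def using G(1) by blast
  ultimately have "F = G" by blast
  then show "semi_distinguished K A F" using FF(1)[OF G(1)] unfolding semi_distinguished_def by blast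
qed

lemma closed_quotients_if_polyhedral:
  assumes "polyhedral_cone K"
  shows "closed_quotients"
proof (rule closed_quotients_if_finite_rays)
  have "{Phi v |v. v \<in> K \<and> dim (Phi v) = 1} \<subseteq> {F. cone_face K F \<and> dim F = 1}"
    using cone_face_Phi by blast
  then show "finite {Phi v |v. v \<in> K \<and> dim (Phi v) = 1}"
    using assms unfolding polyhedral_cone_def by (rule finite_subset)
qed

lemma cond_d_imp_b_if_polyhedral:
  assumes "polyhedral_cone K" and d: "cond_d K A lam"
  shows "cond_b K A lam"
  unfolding cond_b_iff
proof (intro ballI impI)
  fix x assume x: "x \<in> inv_gen" "x \<noteq> 0"
  show "irr x"
  proof (rule irr_if_irr_comparable[OF order_refl _ _ x])
    fix x g h assume "x \<in> inv_gen" "g \<in> Phi x" "A *v g \<in> Phi g" "h \<in> Phi x" "A *v h \<in> Phi h" "x \<in> Phi (g + h)"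
    then show "\<exists>u\<in>inv_gen. \<exists>v\<in>inv_gen. u \<in> Phi g \<and> v \<in> Phi h \<and> x \<in> Phi (u + v)"
      using split_gen_polyhedral[OF closed_quotients_if_polyhedral[OF assms(1)], of x g h] by metis
  qed (use d in \<open>unfold cond_d_iff, blast\<close>)
qed

lemma cond_c_imp_a_if_polyhedral:
  assumes "polyhedral_cone K" "lam = spectral_radius A" "cond_c K A lam"
  shows "cond_a A lam"
proof -
  have cq: "closed_quotients" using closed_quotients_if_polyhedral[OF assms(1)] .
  have chain: "x \<in> Phi y \<or> y \<in> Phi x" if "x \<in> inv_gen" "y \<in> inv_gen" for x y
    using assms(3) that unfolding cond_c_iff by blast
  have int: "interior K \<noteq> {}" using proper by (simp add: proper_cone_def)
  obtain k where k: "k \<in> interior K" using int by blast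
  have kK: "k \<in> K" using k interior_subset by blast
  have PhiK: "v \<in> Phi k" if "v \<in> K" for v
  proof -
    obtain c where "c > 0" "c *\<^sub>R k - v \<in> interior K" using interior_order_unit[OF k] by blast
    then show ?thesis using that interior_subset unfolding Phi_def by (auto intro!: exI[of _ c])
  qed
  obtain x0 where x0: "x0 \<in> inv_gen" "\<And>v. v \<in> Phi k \<Longrightarrow> gen v \<Longrightarrow> v \<in> Phi x0"
    using exists_max_inv_gen[OF kK PhiK[OF f_in_K[OF kK]]] by metis
  have noeig: "v = 0" if "\<mu> > lam" "A *v v = \<mu> *\<^sub>R v" for \<mu> v
    using real_eigenvalue_le_spectral_radius[OF that(2)] that(1) assms(2) by force
  have "z \<in> span (Phi x0)" if "N z = 0" for z
    by (rule null_in_span_top[OF cq x0(1) _ _ int that]) (use x0(2) PhiK noeig in blast)+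
  then show ?thesis unfolding cond_a_iff
    using one_dim_null_if_comparable[OF cq chain x0(1)] by blast
qed

end

theorem theorem7p2:
  fixes K :: "(real ^ 'n) set" and A :: "real ^ 'n ^ 'n" and lam :: real
  assumes "proper_cone K"
    and "A \<in> cone_preserving K"
    and "distinguished_eigenvalue K A lam"
  shows "((cond_a A lam \<longrightarrow> cond_b K A lam) \<and>
          (cond_b K A lam \<longrightarrow> cond_c K A lam) \<and>
          (cond_c K A lam \<longrightarrow> cond_d K A lam) \<and>
          (cond_d K A lam \<longrightarrow> cond_e K A lam)) \<and>
         ((\<forall>F. invariant_face K A F \<and> rel_interior_gen_eigvec A lam F \<longrightarrow>
               (\<exists>\<F>. (\<forall>G\<in>\<F>. semi_distinguished_assoc K A lam G) \<and> F = join_faces K \<F>)) \<longrightarrow>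
          (cond_b K A lam \<longleftrightarrow> cond_c K A lam) \<and> (cond_c K A lam \<longleftrightarrow> cond_d K A lam)) \<and>
         (polyhedral_cone K \<longrightarrow>
          (cond_b K A lam \<longleftrightarrow> cond_c K A lam) \<and> (cond_c K A lam \<longleftrightarrow> cond_d K A lam) \<and>
          (lam = spectral_radius A \<longrightarrow> (cond_a A lam \<longleftrightarrow> cond_b K A lam)))"
proof -
  interpret cone_matrix K A lam using assms by unfold_locales
  note imps = cond_a_imp_b cond_b_imp_c cond_c_imp_d cond_d_imp_e
  show ?thesis
  proof (intro conjI)
    show "(\<forall>F. invariant_face K A F \<and> rel_interior_gen_eigvec A lam F \<longrightarrow>
               (\<exists>\<F>. (\<forall>G\<in>\<F>. semi_distinguished_assoc K A lam G) \<and> F = join_faces K \<F>)) \<longrightarrow>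
          (cond_b K A lam \<longleftrightarrow> cond_c K A lam) \<and> (cond_c K A lam \<longleftrightarrow> cond_d K A lam)"
    proof
      assume "\<forall>F. invariant_face K A F \<and> rel_interior_gen_eigvec A lam F \<longrightarrow>
               (\<exists>\<F>. (\<forall>G\<in>\<F>. semi_distinguished_assoc K A lam G) \<and> F = join_faces K \<F>)"
      then have "cond_d K A lam \<Longrightarrow> cond_b K A lam" using cond_d_imp_b_if_joins by blast
      then show "(cond_b K A lam \<longleftrightarrow> cond_c K A lam) \<and> (cond_c K A lam \<longleftrightarrow> cond_d K A lam)"
        using imps by blast
    qed
    show "polyhedral_cone K \<longrightarrow>
          (cond_b K A lam \<longleftrightarrow> cond_c K A lam) \<and> (cond_c K A lam \<longleftrightarrow> cond_d K A lam) \<and>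
          (lam = spectral_radius A \<longrightarrow> (cond_a A lam \<longleftrightarrow> cond_b K A lam))"
      using imps cond_d_imp_b_if_polyhedral cond_c_imp_a_if_polyhedral by blast
  qed (use imps in blast)+
qed

end
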